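(* Let $1\longrightarrow D\overset{\iota}{\longrightarrow}\widehat G\overset{\lambda}{\longrightarrow}G\longrightarrow 1$ be a short exact sequence of (finite) groups, $n$ a natural number and $\omega\in Z^n(D;U(1))$ an $n$-cocycle whose class lies in $H^n(D;U(1))^G$. Consider the Lyndon-Hochschild-Serre spectral sequence $E_2^{p,q}=H^p(G;H^q(D;U(1)))\Rightarrow H^{p+q}(\widehat G;U(1))$ and the $n$ successive obstructions $$\mathrm d_i^{0,n}\omega=0\in E_i^{i,n+1-i},\qquad i=2,\dots,n+1,$$ where the condition for $i$ is only defined once those for smaller $i$ hold. (a) When all of these obstructions vanish ($i=2,\dots,n+1$), there exists $\widehat\omega\in Z^n(\widehat G;U(1))$ satisfying $\iota^*\widehat\omega=\omega$. (b) When the first $n-1$ of these obstructions vanish ($i=2,\dots,n$), there exist $\omega'\in C^n(\widehat G;U(1))$ and $\theta\in Z^{n+1}(G;U(1))$ satisfying $\iota^*\omega'=\omega$ and $\delta\omega'=\lambda^*\theta$.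
   Context: $C^\bullet(K;U(1))$ denotes the complex of normalised (inhomogeneous) group cochains of a group $K$ with values in the trivial module $U(1)$, $Z^\bullet$ its cocycles, $H^\bullet$ its cohomology and $\delta$ its coboundary operator. $G$ acts on $H^q(D;U(1))$ via conjugation in $\widehat G$, and $H^n(D;U(1))^G=E_2^{0,n}$ denotes the invariants. The spectral sequence is the one of the filtration of $C^\bullet(\widehat G;U(1))$ for which $F^iC^n(\widehat G;U(1))$ is $0$ for $i>n$ and otherwise consists of the normalised $n$-cochains that vanish as soon as $n-i+1$ of their entries lie in $\iota(D)$. Explicitly, - $Z_r^{p,q}=\ker\big(F^pC^{p+q}\overset{\delta}{\to}C^{p+q+1}/F^{p+r}C^{p+q+1}\big)$, - $B_r^{p,q}=\delta\big(F^{p-r+1}C^{p+q-1}\big)\cap F^pC^{p+q}$, - $E_r^{p,q}=Z_r^{p,q}/(B_r^{p,q}+Z_{r-1}^{p+1,q-1})$, and $\mathrm d_r^{p,q}\colon E_r^{p,q}\to E_r^{p+r,q-r+1}$ is induced by $\delta$. $E_{i+1}^{0,n}=\ker \mathrm d_i^{0,n}\subseteq E_i^{0,n}$, so $\mathrm d_i^{0,n}\omega$ makes sense when the class of $\omega$ lies in $\ker\mathrm d_j^{0,n}$ for all $2\le j<i$. *)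

theory Defs
  imports Complex_Main "HOL-Algebra.Coset"
begin

text \<open>Group cochains with values in the circle group \<open>U(1)\<close>, realised as the complex numbers of
  modulus one and hence written multiplicatively. Degrees are integers, so that \<open>C\<^sup>n\<close> is the
  trivial group for \<open>n < 0\<close>.\<close>

definition tuples :: "'a monoid \<Rightarrow> int \<Rightarrow> 'a list set" where
  "tuples K n = {xs. int (length xs) = n \<and> set xs \<subseteq> carrier K}"

text \<open>Cochains take the junk value \<open>1\<close> off \<open>K\<^sup>n\<close>, so that equality of cochains is equality of
  functions.\<close>

definition cochains :: "'a monoid \<Rightarrow> int \<Rightarrow> ('a list \<Rightarrow> complex) monoid" where
  "cochains K n =
    \<lparr>carrier = {f. (\<forall>xs \<in> tuples K n. cmod (f xs) = 1)
                 \<and> (\<forall>xs \<in> tuples K n. \<one>\<^bsub>K\<^esub> \<in> set xs \<longrightarrow> f xs = 1)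
                 \<and> (\<forall>xs. xs \<notin> tuples K n \<longrightarrow> f xs = 1)},
     monoid.mult = (\<lambda>f g xs. f xs * g xs),
     one = (\<lambda>xs. 1)\<rparr>"

definition coboundary :: "'a monoid \<Rightarrow> int \<Rightarrow> ('a list \<Rightarrow> complex) \<Rightarrow> ('a list \<Rightarrow> complex)" where
  "coboundary K n f = (\<lambda>xs. if xs \<in> tuples K (n + 1) then
      f (tl xs)
      * (\<Prod>i<nat n. f (take i xs @ (xs ! i \<otimes>\<^bsub>K\<^esub> xs ! Suc i) # drop (i + 2) xs) powi ((-1) ^ Suc i))
      * f (butlast xs) powi ((-1) ^ Suc (nat n))
    else 1)"

definition cocycles :: "'a monoid \<Rightarrow> int \<Rightarrow> ('a list \<Rightarrow> complex) set" where
  "cocycles K n = kernel (cochains K n) (cochains K (n + 1)) (coboundary K n)"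

definition coboundaries :: "'a monoid \<Rightarrow> int \<Rightarrow> ('a list \<Rightarrow> complex) set" where
  "coboundaries K n = coboundary K (n - 1) ` carrier (cochains K (n - 1))"

definition cohomology :: "'a monoid \<Rightarrow> int \<Rightarrow> ('a list \<Rightarrow> complex) set monoid" where
  "cohomology K n = (cochains K n)\<lparr>carrier := cocycles K n\<rparr> Mod coboundaries K n"

definition coh_class :: "'a monoid \<Rightarrow> int \<Rightarrow> ('a list \<Rightarrow> complex) \<Rightarrow> ('a list \<Rightarrow> complex) set" where
  "coh_class K n f = coboundaries K n #>\<^bsub>cochains K n\<^esub> f"

text \<open>The pullback of an \<open>n\<close>-cochain along a homomorphism \<open>\<phi>\<close> with source \<open>K\<close>.\<close>

definition pullback ::
  "'a monoid \<Rightarrow> int \<Rightarrow> ('a \<Rightarrow> 'b) \<Rightarrow> ('b list \<Rightarrow> complex) \<Rightarrow> ('a list \<Rightarrow> complex)" where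
  "pullback K n \<phi> f = (\<lambda>xs. if xs \<in> tuples K n then f (map \<phi> xs) else 1)"

text \<open>For \<open>h\<close> in the middle group \<open>E\<close> of the extension, \<open>d \<mapsto> \<iota>\<inverse>(h\<inverse> \<iota>(d) h)\<close>.\<close>

definition conj_aut :: "'d monoid \<Rightarrow> 'e monoid \<Rightarrow> ('d \<Rightarrow> 'e) \<Rightarrow> 'e \<Rightarrow> 'd \<Rightarrow> 'd" where
  "conj_aut D E \<iota> h d = inv_into (carrier D) \<iota> (inv\<^bsub>E\<^esub> h \<otimes>\<^bsub>E\<^esub> \<iota> d \<otimes>\<^bsub>E\<^esub> h)"

text \<open>The action of \<open>\<gamma> \<in> G\<close> on a cohomology class \<open>c\<close> of \<open>D\<close> is conjugation by a lift of \<open>\<gamma>\<close> along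
  \<open>\<pi> : E \<rightarrow> G\<close>; the resulting class depends neither on the lift nor on the representative of \<open>c\<close>.\<close>

definition coh_action ::
  "'d monoid \<Rightarrow> 'e monoid \<Rightarrow> ('d \<Rightarrow> 'e) \<Rightarrow> ('e \<Rightarrow> 'g) \<Rightarrow> int \<Rightarrow> 'g
    \<Rightarrow> ('d list \<Rightarrow> complex) set \<Rightarrow> ('d list \<Rightarrow> complex) set" where
  "coh_action D E \<iota> \<pi> n \<gamma> c =
    the_elem ((\<lambda>f. coh_class D n
      (pullback D n (conj_aut D E \<iota> (inv_into (carrier E) \<pi> \<gamma>)) f)) ` c)"

definition coh_invariants ::
  "'d monoid \<Rightarrow> 'e monoid \<Rightarrow> 'g monoid \<Rightarrow> ('d \<Rightarrow> 'e) \<Rightarrow> ('e \<Rightarrow> 'g) \<Rightarrow> int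
    \<Rightarrow> ('d list \<Rightarrow> complex) set set" where
  "coh_invariants D E G \<iota> \<pi> n =
    {c \<in> carrier (cohomology D n). \<forall>\<gamma> \<in> carrier G. coh_action D E \<iota> \<pi> n \<gamma> c = c}"

text \<open>The spectral sequence of the filtration of \<open>C\<^sup>\<bullet>(K; U(1))\<close> determined by a subgroup \<open>N\<close>
  (to be taken as \<open>\<iota>(D)\<close>). For \<open>i \<le> 0\<close> the filtration step is all of \<open>C\<^sup>n\<close>.\<close>

definition filt :: "'a monoid \<Rightarrow> 'a set \<Rightarrow> int \<Rightarrow> int \<Rightarrow> ('a list \<Rightarrow> complex) set" where
  "filt K N i n =
    (if i > n then {\<one>\<^bsub>cochains K n\<^esub>}
     else {f \<in> carrier (cochains K n). \<forall>xs \<in> tuples K n.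
             n - i + 1 \<le> int (card {j. j < length xs \<and> xs ! j \<in> N}) \<longrightarrow> f xs = 1})"

definition ss_Z :: "'a monoid \<Rightarrow> 'a set \<Rightarrow> int \<Rightarrow> int \<Rightarrow> int \<Rightarrow> ('a list \<Rightarrow> complex) set" where
  "ss_Z K N r p q =
    {f \<in> filt K N p (p + q). coboundary K (p + q) f \<in> filt K N (p + r) (p + q + 1)}"

definition ss_B :: "'a monoid \<Rightarrow> 'a set \<Rightarrow> int \<Rightarrow> int \<Rightarrow> int \<Rightarrow> ('a list \<Rightarrow> complex) set" where
  "ss_B K N r p q =
    coboundary K (p + q - 1) ` filt K N (p - r + 1) (p + q - 1) \<inter> filt K N p (p + q)"

definition ss_denom :: "'a monoid \<Rightarrow> 'a set \<Rightarrow> int \<Rightarrow> int \<Rightarrow> int \<Rightarrow> ('a list \<Rightarrow> complex) set" where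
  "ss_denom K N r p q =
    ss_B K N r p q <#>\<^bsub>cochains K (p + q)\<^esub> ss_Z K N (r - 1) (p + 1) (q - 1)"

definition ss_E :: "'a monoid \<Rightarrow> 'a set \<Rightarrow> int \<Rightarrow> int \<Rightarrow> int \<Rightarrow> ('a list \<Rightarrow> complex) set monoid" where
  "ss_E K N r p q = (cochains K (p + q))\<lparr>carrier := ss_Z K N r p q\<rparr> Mod ss_denom K N r p q"

text \<open>The differential \<open>E\<^sub>r\<^sup>p\<^sup>,\<^sup>q \<rightarrow> E\<^sub>r\<^sup>p\<^sup>+\<^sup>r\<^sup>,\<^sup>q\<^sup>-\<^sup>r\<^sup>+\<^sup>1\<close> sends the coset of \<open>f\<close> to the coset of \<open>\<delta>f\<close>.\<close>

definition ss_d ::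
  "'a monoid \<Rightarrow> 'a set \<Rightarrow> int \<Rightarrow> int \<Rightarrow> int \<Rightarrow> ('a list \<Rightarrow> complex) set \<Rightarrow> ('a list \<Rightarrow> complex) set" where
  "ss_d K N r p q X =
    the_elem ((\<lambda>f. ss_denom K N r (p + r) (q - r + 1) #>\<^bsub>cochains K (p + q + 1)\<^esub>
                     coboundary K (p + q) f) ` X)"

text \<open>The map \<open>E\<^sub>r\<^sup>0\<^sup>,\<^sup>n \<rightarrow> H\<^sup>n(D; U(1))\<close>, \<open>[f] \<mapsto> [\<iota>\<^sup>* f]\<close>. For \<open>r \<ge> 2\<close> it is injective and compatible
  with the inclusions \<open>E\<^sub>r\<^sub>+\<^sub>1\<^sup>0\<^sup>,\<^sup>n = ker d\<^sub>r\<^sup>0\<^sup>,\<^sup>n \<subseteq> E\<^sub>r\<^sup>0\<^sup>,\<^sup>n\<close>, and for \<open>r = 2\<close> its image is \<open>H\<^sup>n(D; U(1))\<^sup>G\<close>;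
  so it is the identification of \<open>E\<^sub>r\<^sup>0\<^sup>,\<^sup>n\<close> with a group of cohomology classes of \<open>D\<close>.\<close>

definition edge ::
  "'d monoid \<Rightarrow> 'e monoid \<Rightarrow> ('d \<Rightarrow> 'e) \<Rightarrow> int \<Rightarrow> ('e list \<Rightarrow> complex) set
    \<Rightarrow> ('d list \<Rightarrow> complex) set" where
  "edge D E \<iota> n X = the_elem ((\<lambda>f. coh_class D n (pullback D n \<iota> f)) ` X)"

text \<open>The element of \<open>E\<^sub>r\<^sup>0\<^sup>,\<^sup>n\<close> given by the class of \<open>\<omega> \<in> Z\<^sup>n(D; U(1))\<close>. It is meaningful if that
  class is \<open>G\<close>-invariant and \<open>d\<^sub>2, \<dots>, d\<^sub>r\<^sub>-\<^sub>1\<close> vanish on it, and unspecified otherwise.\<close>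

definition page_class ::
  "'d monoid \<Rightarrow> 'e monoid \<Rightarrow> ('d \<Rightarrow> 'e) \<Rightarrow> int \<Rightarrow> int \<Rightarrow> ('d list \<Rightarrow> complex)
    \<Rightarrow> ('e list \<Rightarrow> complex) set" where
  "page_class D E \<iota> n r \<omega> =
    (THE X. X \<in> carrier (ss_E E (\<iota> ` carrier D) r 0 n) \<and> edge D E \<iota> n X = coh_class D n \<omega>)"

definition obstruction_vanishes ::
  "'d monoid \<Rightarrow> 'e monoid \<Rightarrow> ('d \<Rightarrow> 'e) \<Rightarrow> int \<Rightarrow> ('d list \<Rightarrow> complex) \<Rightarrow> int \<Rightarrow> bool" where
  "obstruction_vanishes D E \<iota> n \<omega> i \<longleftrightarrow>
    ss_d E (\<iota> ` carrier D) i 0 n (page_class D E \<iota> n i \<omega>)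
      = \<one>\<^bsub>ss_E E (\<iota> ` carrier D) i i (n + 1 - i)\<^esub>"

end

theory Submission
  imports Defs
begin

text \<open>
  Represent a tuple by the vertices \<open>p\<^sub>0, \<dots>, p\<^sub>m\<close> of the corresponding simplex, so that its entries
  are the quotients \<open>p\<^sub>j\<inverse> p\<^sub>j\<^sub>+\<^sub>1\<close> and the faces in the coboundary omit one vertex. Write \<open>N\<close> for the
  image of \<open>D\<close>.

  A cochain of \<open>N\<close> extends by \<open>1\<close> to the middle group, and \<open>F\<^sup>1C\<^sup>n\<close> consists of the cochains that
  restrict trivially to \<open>N\<close>; hence an element of \<open>E\<^sub>r\<^sup>0\<^sup>,\<^sup>n\<close> is determined by its restriction to
  \<open>N\<close>. If \<open>d\<^sub>r\<close> kills the class of \<open>f\<close>, then \<open>\<delta>f = \<delta>g + z\<close> with \<open>g \<in> F\<^sup>1C\<^sup>n\<close> and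
  \<open>z \<in> F\<^sup>r\<^sup>+\<^sup>1C\<^sup>n\<^sup>+\<^sup>1\<close>, so \<open>f - g\<close> lives on the next page and has the same restriction. After
  \<open>d\<^sub>n\<^sub>+\<^sub>1\<close> the coboundary lies in \<open>F\<^sup>n\<^sup>+\<^sup>2C\<^sup>n\<^sup>+\<^sup>1 = 0\<close>, which is (a). After \<open>d\<^sub>n\<close> it is a cocycle that
  vanishes as soon as one entry lies in \<open>N\<close>; its cocycle condition on a simplex with two consecutive
  vertices in the same coset of \<open>N\<close> shows that it depends on the cosets of the vertices only,
  which is (b).

  The induction starts at \<open>r = 2\<close>. A tuple with one entry outside \<open>N\<close> has its vertices in two
  cosets, \<open>p\<^sub>0N\<close> and then \<open>p\<^sub>0sN\<close> for a representative \<open>s\<close>. Translating the vertices in the first coset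
  by \<open>s\<close> moves them into the second, where \<open>\<omega>\<close> can be evaluated. This conjugates the initial entries
  by \<open>s\<close>, and invariance of the class provides \<open>\<eta>\<close> with \<open>s\<^sup>*\<omega> = \<omega> + \<delta>\<eta>\<close>, which corrects
  the discrepancy on the last face.
\<close>

section \<open>Simplices and coboundaries\<close>

text \<open>\<open>p \<circ> skip i\<close> omits the vertex \<open>p i\<close>, and \<open>diffs K m p\<close> is the tuple of the simplex with
  vertices \<open>p 0, \<dots>, p m\<close>; all other values of \<open>p\<close> are ignored.\<close>

definition skip :: "nat \<Rightarrow> nat \<Rightarrow> nat" where
  "skip i j = (if j < i then j else Suc j)"

definition diffs :: "'a monoid \<Rightarrow> nat \<Rightarrow> (nat \<Rightarrow> 'a) \<Rightarrow> 'a list" where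
  "diffs K m p = map (\<lambda>j. inv\<^bsub>K\<^esub> p j \<otimes>\<^bsub>K\<^esub> p (Suc j)) [0..<m]"

lemma length_diffs [simp]: "length (diffs K m p) = m"
  by (simp add: diffs_def)

lemma nth_diffs [simp]: "j < m \<Longrightarrow> diffs K m p ! j = inv\<^bsub>K\<^esub> p j \<otimes>\<^bsub>K\<^esub> p (Suc j)"
  by (simp add: diffs_def)

lemma diffs_cong: "(\<And>j. j \<le> m \<Longrightarrow> p j = q j) \<Longrightarrow> diffs K m p = diffs K m q"
  by (auto simp: diffs_def)

lemma set_diffs: "set (diffs K m p) = {inv\<^bsub>K\<^esub> p j \<otimes>\<^bsub>K\<^esub> p (Suc j) | j. j < m}"
  by (auto simp: diffs_def)

text \<open>The simplicial identity for faces; it pairs off the terms of a double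
  coboundary.\<close>

lemma skip_skip: "i \<le> j \<Longrightarrow> skip i \<circ> skip j = skip (Suc j) \<circ> skip i"
  by (auto simp: skip_def fun_eq_iff)

lemma range_comp_subset: "range p \<subseteq> A \<Longrightarrow> range (p \<circ> f) \<subseteq> A"
  by auto

lemma diffs_in_tuples:
  assumes "group K" "range p \<subseteq> carrier K"
  shows "diffs K m p \<in> tuples K (int m)"
proof -
  interpret group K by fact
  have "p j \<in> carrier K" for j using assms(2) by auto
  then show ?thesis by (auto simp: tuples_def diffs_def)
qed

text \<open>The vertices are the partial products of the entries, started at an arbitrary
  \<open>x\<close>. Since \<open>p\<close> is defined on all naturals, every
  \<open>p \<circ> skip i\<close> is admissible again without bounds on the index.\<close>

lemma tuples_diffsE:
  fixes K :: "'a monoid" (structure)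
  assumes "group K" "x \<in> carrier K" "xs \<in> tuples K (int m)"
  obtains p where "range p \<subseteq> carrier K" "p 0 = x" "xs = diffs K m p"
proof -
  interpret group K by fact
  have "\<exists>p. range p \<subseteq> carrier K \<and> p 0 = x \<and> xs = diffs K m p"
    using assms(2,3)
  proof (induction m arbitrary: xs x)
    case 0
    then show ?case by (intro exI[of _ "\<lambda>_. x"]) (auto simp: tuples_def diffs_def)
  next
    case (Suc m)
    then obtain y ys where xs: "xs = y # ys" by (cases xs) (auto simp: tuples_def)
    then have y: "y \<in> carrier K" and ys: "ys \<in> tuples K (int m)"
      using Suc.prems by (auto simp: tuples_def)
    then obtain p where p: "range p \<subseteq> carrier K" "p 0 = x \<otimes> y" "ys = diffs K m p"
      using Suc.IH[of "x \<otimes> y" ys] Suc.prems by auto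
    \<comment> \<open>The vertices of the tail start at \<open>x \<otimes> y\<close>, and
      \<open>case_nat x p\<close> puts \<open>x\<close> in front of them; hence the induction over
      all \<open>x\<close>.\<close>
    have "diffs K (Suc m) (case_nat x p) = (inv x \<otimes> (x \<otimes> y)) # diffs K m p"
      using p(2) by (simp add: diffs_def upt_conv_Cons map_Suc_upt[symmetric] del: upt_Suc)
    moreover have "inv x \<otimes> (x \<otimes> y) = y"
      using y Suc.prems by (simp add: m_assoc[symmetric])
    ultimately show ?case
      using p xs y Suc.prems by (intro exI[of _ "case_nat x p"])
        (auto simp: image_subset_iff split: nat.splits)
  qed
  then show ?thesis using that by blast
qed

text \<open>Omitting the first or last vertex drops an end entry, omitting an inner one multiplies
  the two entries next to it. So the three kinds of factors in \<open>coboundary\<close> become one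
  alternating product over faces.\<close>

lemma coboundary_diffs:
  fixes K :: "'a monoid" (structure)
  assumes "group K" "range p \<subseteq> carrier K"
  shows "coboundary K (int m) f (diffs K (Suc m) p)
           = (\<Prod>i\<le>Suc m. f (diffs K m (p \<circ> skip i)) powi ((-1) ^ i))"
proof -
  interpret group K by fact
  have p: "p j \<in> carrier K" for j using assms(2) by auto
  let ?xs = "diffs K (Suc m) p"
  have "tl ?xs = diffs K m (p \<circ> skip 0)"
    by (rule nth_equalityI) (auto simp: nth_tl skip_def)
  moreover have "butlast ?xs = diffs K m (p \<circ> skip (Suc m))"
    by (rule nth_equalityI) (auto simp: nth_butlast skip_def)
  moreover have "take i ?xs @ (?xs ! i \<otimes> ?xs ! Suc i) # drop (i + 2) ?xs
                   = diffs K m (p \<circ> skip (Suc i))" if "i < m" for i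
  proof (rule nth_equalityI)
    fix j assume "j < length (take i ?xs @ (?xs ! i \<otimes> ?xs ! Suc i) # drop (i + 2) ?xs)"
    then have j: "j < m" using that by simp
    have "inv p i \<otimes> p (Suc i) \<otimes> (inv p (Suc i) \<otimes> p (Suc (Suc i))) = inv p i \<otimes> p (Suc (Suc i))"
      using p by (metis inv_closed m_assoc m_closed r_inv l_one)
    then show "(take i ?xs @ (?xs ! i \<otimes> ?xs ! Suc i) # drop (i + 2) ?xs) ! j
                 = diffs K m (p \<circ> skip (Suc i)) ! j"
      using that j by (cases j i rule: linorder_cases)
        (auto simp: nth_append skip_def min_def nth_Cons')
  qed (use that in auto)
  moreover have "?xs \<in> tuples K (int m + 1)"
    using diffs_in_tuples[OF assms, of "Suc m"] by (simp add: add.commute)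
  moreover have "(\<Prod>i\<le>Suc m. t i) = t 0 * (\<Prod>i<m. t (Suc i)) * t (Suc m)" for t :: "nat \<Rightarrow> complex"
    by (simp only: prod.atMost_Suc_shift) (simp add: lessThan_Suc_atMost[symmetric])
  ultimately show ?thesis
    by (simp add: coboundary_def del: prod.atMost_Suc)
qed

section \<open>Cochain groups and the coboundary operator\<close>

lemma cochains_simps [simp]:
  "monoid.mult (cochains K n) = (\<lambda>f g xs. f xs * g xs)" "one (cochains K n) = (\<lambda>xs. 1)"
  by (simp_all add: cochains_def)

lemma carrier_cochains: "f \<in> carrier (cochains K n) \<longleftrightarrow>
   (\<forall>xs \<in> tuples K n. cmod (f xs) = 1) \<and> (\<forall>xs \<in> tuples K n. \<one>\<^bsub>K\<^esub> \<in> set xs \<longrightarrow> f xs = 1)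
     \<and> (\<forall>xs. xs \<notin> tuples K n \<longrightarrow> f xs = 1)"
  by (simp add: cochains_def)

lemma cochain_norm: "f \<in> carrier (cochains K n) \<Longrightarrow> cmod (f xs) = 1"
  by (cases "xs \<in> tuples K n") (auto simp: carrier_cochains)

lemma cochain_nonzero: "f \<in> carrier (cochains K n) \<Longrightarrow> f xs \<noteq> 0"
  using cochain_norm[of f K n xs] by auto

lemma cochain_one: "f \<in> carrier (cochains K n) \<Longrightarrow> \<one>\<^bsub>K\<^esub> \<in> set xs \<Longrightarrow> f xs = 1"
  by (cases "xs \<in> tuples K n") (auto simp: carrier_cochains)

lemma cochain_outside: "f \<in> carrier (cochains K n) \<Longrightarrow> xs \<notin> tuples K n \<Longrightarrow> f xs = 1"
  by (auto simp: carrier_cochains)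

lemma comm_group_cochains: "comm_group (cochains K n)"
proof (rule comm_groupI)
  fix f assume "f \<in> carrier (cochains K n)"
  then show "\<exists>g\<in>carrier (cochains K n). g \<otimes>\<^bsub>cochains K n\<^esub> f = \<one>\<^bsub>cochains K n\<^esub>"
    by (intro bexI[of _ "\<lambda>xs. inverse (f xs)"])
       (simp_all add: cochain_nonzero, auto simp: carrier_cochains norm_inverse)
qed (auto simp: carrier_cochains norm_mult)

lemma inv_cochains:
  assumes "f \<in> carrier (cochains K n)"
  shows "inv\<^bsub>cochains K n\<^esub> f = (\<lambda>xs. inverse (f xs))"
proof -
  interpret comm_group "cochains K n" by (rule comm_group_cochains)
  show ?thesis
    using assms by (intro inv_equality)
      (simp_all add: cochain_nonzero, auto simp: carrier_cochains norm_inverse)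
qed

lemma cochains_neg: "n < 0 \<Longrightarrow> f \<in> carrier (cochains K n) \<Longrightarrow> f = (\<lambda>_. 1)"
  by (auto simp: carrier_cochains tuples_def fun_eq_iff)

text \<open>Normalisation seen on vertices: a repeated vertex gives a unit entry.\<close>

lemma cochain_diffs_one:
  fixes K :: "'a monoid" (structure)
  assumes "group K" "range p \<subseteq> carrier K" "f \<in> carrier (cochains K n)" "j < m" "p j = p (Suc j)"
  shows "f (diffs K m p) = 1"
proof -
  interpret group K by fact
  have "p j \<in> carrier K" using assms by auto
  then have "\<one> \<in> set (diffs K m p)" using assms by (force simp: set_diffs)
  then show ?thesis using cochain_one assms by metis
qed

lemma coboundary_outside: "xs \<notin> tuples K (n + 1) \<Longrightarrow> coboundary K n f xs = 1"
  by (simp add: coboundary_def)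

lemma coboundary_one [simp]: "coboundary K n (\<lambda>_. 1) = (\<lambda>_. 1)"
  by (auto simp: coboundary_def)

lemma cochain_eqI:
  assumes "group K" "\<And>xs. xs \<notin> tuples K (int m) \<Longrightarrow> f xs = 1" "\<And>xs. xs \<notin> tuples K (int m) \<Longrightarrow> g xs = 1"
    "\<And>p. range p \<subseteq> carrier K \<Longrightarrow> f (diffs K m p) = g (diffs K m p)"
  shows "f = g"
proof
  fix xs
  show "f xs = g xs"
  proof (cases "xs \<in> tuples K (int m)")
    case True
    obtain p where "range p \<subseteq> carrier K" "xs = diffs K m p"
      using tuples_diffsE[OF assms(1) _ True] group.is_monoid[OF assms(1)] monoid.one_closed by metis
    then show ?thesis using assms by auto
  qed (use assms in auto)
qed

lemma powi_mult_minus: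
  fixes a b :: complex
  assumes "a \<noteq> 0"
  shows "a powi ((-1) ^ i) * a powi ((-1) ^ Suc i) = 1"
  using assms by (simp add: power_int_minus)

lemma coboundary_closed:
  fixes K :: "'a monoid" (structure)
  assumes "group K" "f \<in> carrier (cochains K n)"
  shows "coboundary K n f \<in> carrier (cochains K (n + 1))"
proof (cases "n < 0")
  case True
  then show ?thesis using cochains_neg[OF True assms(2)] by (auto simp: carrier_cochains)
next
  case False
  then obtain m where n: "n = int m" using nat_0_le by (metis not_less)
  interpret group K by fact
  note f = assms(2)
  show ?thesis
    unfolding carrier_cochains
  proof (intro conjI ballI impI allI)
    fix xs assume "xs \<in> tuples K (n + 1)"
    then have "xs \<in> tuples K (int (Suc m))" by (simp add: n add.commute)
    then obtain p where p: "range p \<subseteq> carrier K" and xs: "xs = diffs K (Suc m) p"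
      using tuples_diffsE[OF assms(1) one_closed] by metis
    show "cmod (coboundary K n f xs) = 1"
      using cochain_norm[OF f]
      by (simp add: n xs coboundary_diffs[OF assms(1) p] prod_norm[symmetric] norm_power_int
          del: prod.atMost_Suc)
    assume "\<one> \<in> set xs"
    then obtain j where j: "j \<le> m" "\<one> = inv p j \<otimes> p (Suc j)"
      by (auto simp: xs set_diffs less_Suc_eq_le)
    then have pj: "p (Suc j) = p j"
      using p by (metis inv_equality inv_inv inv_closed l_inv range_subsetD)
    let ?t = "\<lambda>i. f (diffs K m (p \<circ> skip i)) powi ((-1) ^ i)"
    \<comment> \<open>Every face other than \<open>j\<close> and \<open>Suc j\<close> still contains
      the repeated vertex; those two faces coincide and enter with opposite signs.\<close>
    have "?t i = 1" if "i \<le> Suc m" "i \<noteq> j" "i \<noteq> Suc j" for i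
    proof -
      have "f (diffs K m (p \<circ> skip i)) = 1"
      proof (cases "i < j")
        case True
        then show ?thesis
          using pj j that by (intro cochain_diffs_one[OF assms(1) _ f, of _ "j - 1"])
            (auto simp: skip_def p[THEN range_subsetD])
      next
        case False
        then show ?thesis
          using pj j that by (intro cochain_diffs_one[OF assms(1) _ f, of _ j])
            (auto simp: skip_def p[THEN range_subsetD])
      qed
      then show ?thesis by simp
    qed
    then have "(\<Prod>i\<le>Suc m. ?t i) = (\<Prod>i\<in>{j, Suc j}. ?t i)"
      using j by (intro prod.mono_neutral_right) auto
    also have "\<dots> = ?t j * ?t (Suc j)" by simp
    also have "diffs K m (p \<circ> skip (Suc j)) = diffs K m (p \<circ> skip j)"
      by (rule diffs_cong) (auto simp: skip_def pj less_Suc_eq)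
    also have "?t j * f (diffs K m (p \<circ> skip j)) powi ((-1) ^ Suc j) = 1"
      by (rule powi_mult_minus) (rule cochain_nonzero[OF f])
    finally show "coboundary K n f xs = 1"
      by (simp only: n xs coboundary_diffs[OF assms(1) p])
  qed (simp add: coboundary_outside)
qed

lemma coboundary_mult:
  "coboundary K n (\<lambda>xs. f xs * g xs) = (\<lambda>xs. coboundary K n f xs * coboundary K n g xs)"
  by (auto simp: coboundary_def power_int_mult_distrib prod.distrib fun_eq_iff)

lemma coboundary_inverse:
  "coboundary K n (\<lambda>xs. inverse (f xs)) = (\<lambda>xs. inverse (coboundary K n f xs))"
  by (auto simp: coboundary_def power_int_inverse prod_inversef[unfolded o_def] fun_eq_iff)

lemma powi_sign_mult: "((a::complex) powi ((-1) ^ i)) powi ((-1) ^ j) = a powi ((-1) ^ (i + j))"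
  by (simp add: power_int_mult[symmetric] power_add)

lemma prod_powi: "(\<Prod>i\<in>A. f i) powi k = (\<Prod>i\<in>A. (f i :: complex) powi k)"
  by (induction A rule: infinite_finite_induct) (auto simp: power_int_mult_distrib)

lemma coboundary_coboundary:
  assumes "group K" "f \<in> carrier (cochains K n)"
  shows "coboundary K (n + 1) (coboundary K n f) = (\<lambda>_. 1)"
proof (cases "n < 0")
  case True
  then show ?thesis using cochains_neg[OF True assms(2)] by simp
next
  case False
  then obtain m where n: "n = int m" using nat_0_le by (metis not_less)
  note f = assms(2)
  show ?thesis
  proof (rule cochain_eqI[OF assms(1), of "Suc (Suc m)"])
    fix p :: "nat \<Rightarrow> 'a" assume p: "range p \<subseteq> carrier K"
    \<comment> \<open>A pair \<open>(i, j)\<close> omits vertex \<open>i\<close> first and then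
      vertex \<open>j\<close> of what is left. By \<open>skip_skip\<close>, the pairs
      \<open>(i, j)\<close> with \<open>i \<le> j\<close> and \<open>(Suc j, i)\<close> give the
      same face, with opposite signs.\<close>
    let ?h = "\<lambda>(i, j). f (diffs K m (p \<circ> (skip i \<circ> skip j))) powi ((-1) ^ (i + j))"
    let ?A = "{(i, j). i \<le> j \<and> j \<le> Suc m}" and ?B = "{(i, j). j < i \<and> i \<le> Suc (Suc m)}"
    have "coboundary K (n + 1) (coboundary K n f) (diffs K (Suc (Suc m)) p)
        = coboundary K (int (Suc m)) (coboundary K (int m) f) (diffs K (Suc (Suc m)) p)"
      by (simp add: n add.commute)
    also have "\<dots> = (\<Prod>i\<le>Suc (Suc m). \<Prod>j\<le>Suc m. ?h (i, j))"
      unfolding coboundary_diffs[OF assms(1) p] coboundary_diffs[OF assms(1) range_comp_subset[OF p]]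
        prod_powi powi_sign_mult
      by (simp only: o_assoc add.commute split)
    also have "\<dots> = prod ?h ({..Suc (Suc m)} \<times> {..Suc m})"
      by (simp add: prod.cartesian_product del: prod.atMost_Suc)
    also have "{..Suc (Suc m)} \<times> {..Suc m} = ?A \<union> ?B" by auto
    also have "prod ?h (?A \<union> ?B) = prod ?h ?A * prod ?h ?B"
      by (rule prod.union_disjoint)
         (auto intro: finite_subset[of _ "{..Suc (Suc m)} \<times> {..Suc (Suc m)}"])
    also have "prod ?h ?B = prod (\<lambda>(i, j). ?h (Suc j, i)) ?A"
      by (rule prod.reindex_bij_witness[of _ "\<lambda>(i, j). (Suc j, i)" "\<lambda>(i, j). (j, i - 1)"])
         (auto dest!: less_imp_Suc_add)
    also have "prod ?h ?A * prod (\<lambda>(i, j). ?h (Suc j, i)) ?A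
                 = (\<Prod>x\<in>?A. ?h x * (\<lambda>(i, j). ?h (Suc j, i)) x)"
      by (simp only: prod.distrib)
    also have "\<dots> = 1"
    proof (rule prod.neutral, clarify)
      fix i j :: nat assume "i \<le> j"
      then show "f (diffs K m (p \<circ> (skip i \<circ> skip j))) powi ((-1) ^ (i + j))
          * f (diffs K m (p \<circ> (skip (Suc j) \<circ> skip i))) powi ((-1) ^ (Suc j + i)) = 1"
        using powi_mult_minus[OF cochain_nonzero[OF f], of _ "i + j"]
        by (simp only: skip_skip add_Suc add.commute[of j i])
    qed
    finally show "coboundary K (n + 1) (coboundary K n f) (diffs K (Suc (Suc m)) p) = 1" .
  next
    fix xs assume "xs \<notin> tuples K (int (Suc (Suc m)))"
    then show "coboundary K (n + 1) (coboundary K n f) xs = 1"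
      by (intro coboundary_outside) (simp add: n algebra_simps)
  qed simp
qed

section \<open>Functoriality under homomorphisms\<close>

lemma pullback_mult: "pullback K n \<phi> (\<lambda>xs. f xs * g xs) = (\<lambda>xs. pullback K n \<phi> f xs * pullback K n \<phi> g xs)"
  by (auto simp: pullback_def)

lemma pullback_inverse: "pullback K n \<phi> (\<lambda>xs. inverse (f xs)) = (\<lambda>xs. inverse (pullback K n \<phi> f xs))"
  by (auto simp: pullback_def)

lemma pullback_closed:
  assumes "group K" "group L" "\<phi> \<in> hom K L" "f \<in> carrier (cochains L n)"
  shows "pullback K n \<phi> f \<in> carrier (cochains K n)"
proof -
  have one: "\<phi> \<one>\<^bsub>K\<^esub> = \<one>\<^bsub>L\<^esub>"
    using assms(1-3) by (simp add: hom_one)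
  show ?thesis
    unfolding carrier_cochains using cochain_norm[OF assms(4)] cochain_one[OF assms(4)]
    by (auto simp: pullback_def one[symmetric])
qed

lemma map_diffs:
  assumes "group K" "group L" "\<phi> \<in> hom K L" "range p \<subseteq> carrier K"
  shows "map \<phi> (diffs K m p) = diffs L m (\<phi> \<circ> p)"
proof -
  interpret group_hom K L \<phi> using assms by (simp add: group_hom_def group_hom_axioms_def)
  show ?thesis using assms(4) by (auto simp: diffs_def image_subset_iff)
qed

text \<open>A homomorphism sends the simplex on \<open>p\<close> to the simplex on
  \<open>\<phi> \<circ> p\<close>, and composing with \<open>\<phi>\<close> commutes with omitting
  vertices.\<close>

lemma coboundary_pullback:
  assumes "group K" "group L" "\<phi> \<in> hom K L" "f \<in> carrier (cochains L n)"
  shows "coboundary K n (pullback K n \<phi> f) = pullback K (n + 1) \<phi> (coboundary L n f)"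
proof (cases "n < 0")
  case True
  then have "f = (\<lambda>_. 1)" using assms(4) cochains_neg by blast
  then show ?thesis by (simp add: pullback_def)
next
  case False
  then obtain m where n: "n = int m" using nat_0_le by (metis not_less)
  show ?thesis
  proof (rule cochain_eqI[OF assms(1), of "Suc m"])
    fix p :: "nat \<Rightarrow> 'a" assume p: "range p \<subseteq> carrier K"
    then have q: "range (\<phi> \<circ> p) \<subseteq> carrier L" using assms(3) by (auto simp: hom_def)
    have t: "diffs K m (p \<circ> skip i) \<in> tuples K (int m)" for i
      by (rule diffs_in_tuples[OF assms(1) range_comp_subset[OF p]])
    have t': "diffs K (Suc m) p \<in> tuples K (int m + 1)"
      using diffs_in_tuples[OF assms(1) p, of "Suc m"] by (simp add: add.commute)
    show "coboundary K n (pullback K n \<phi> f) (diffs K (Suc m) p)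
            = pullback K (n + 1) \<phi> (coboundary L n f) (diffs K (Suc m) p)"
      using t t'
      by (simp only: n coboundary_diffs[OF assms(1) p] coboundary_diffs[OF assms(2) q] pullback_def
          map_diffs[OF assms(1-3) p] map_diffs[OF assms(1-3) range_comp_subset[OF p]] o_assoc if_True)
  qed (simp_all add: n coboundary_outside pullback_def add.commute)
qed

lemma cocycles_iff:
  "f \<in> cocycles K n \<longleftrightarrow> f \<in> carrier (cochains K n) \<and> coboundary K n f = (\<lambda>_. 1)"
  by (simp add: cocycles_def kernel_def)

section \<open>The spectral sequence\<close>

lemma filt_iff:
  "f \<in> filt K N i n \<longleftrightarrow> (if n < i then f = (\<lambda>_. 1) else f \<in> carrier (cochains K n) \<and>
     (\<forall>xs \<in> tuples K n. n - i + 1 \<le> int (card {j. j < length xs \<and> xs ! j \<in> N}) \<longrightarrow> f xs = 1))"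
  by (simp add: filt_def)

lemma one_cochain [simp]: "(\<lambda>_. 1) \<in> carrier (cochains K n)"
  by (simp add: carrier_cochains)

lemma cochain_mult:
  "f \<in> carrier (cochains K n) \<Longrightarrow> g \<in> carrier (cochains K n) \<Longrightarrow> (\<lambda>xs. f xs * g xs) \<in> carrier (cochains K n)"
  by (simp add: carrier_cochains norm_mult)

lemma cochain_inverse:
  "f \<in> carrier (cochains K n) \<Longrightarrow> (\<lambda>xs. inverse (f xs)) \<in> carrier (cochains K n)"
  by (simp add: carrier_cochains norm_inverse)

lemma filt_subset: "filt K N i n \<subseteq> carrier (cochains K n)"
  by (auto simp: filt_iff split: if_splits)

lemma filt_antimono: "i \<le> j \<Longrightarrow> filt K N j n \<subseteq> filt K N i n"
  by (auto simp: filt_iff split: if_splits)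

lemma card_positions_le: "card {j. j < length xs \<and> P j} \<le> length xs"
  using card_mono[of "{..<length xs}" "{j. j < length xs \<and> P j}"] by auto

text \<open>The threshold \<open>n - i + 1\<close> exceeds the number \<open>n\<close> of entries,
  so the condition is void; if \<open>n < i\<close>, then \<open>n\<close> is negative and both
  sides are trivial.\<close>

lemma filt_nonpos:
  assumes "i \<le> 0" shows "filt K N i n = carrier (cochains K n)"
proof (cases "n < i")
  case True
  then show ?thesis
    using assms cochains_neg[of n] filt_subset[of K N i n] by (fastforce simp: filt_iff)
next
  case False
  have "\<not> n - i + 1 \<le> int (card {j. j < length xs \<and> xs ! j \<in> N})" if "xs \<in> tuples K n" for xs
    using card_positions_le[of xs "\<lambda>j. xs ! j \<in> N"] that assms by (simp add: tuples_def)
  then show ?thesis using False by (auto simp: filt_iff)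
qed

lemma filt_mult: "f \<in> filt K N i n \<Longrightarrow> g \<in> filt K N i n \<Longrightarrow> (\<lambda>xs. f xs * g xs) \<in> filt K N i n"
  by (auto simp: filt_iff cochain_mult split: if_splits)

lemma filt_inverse: "f \<in> filt K N i n \<Longrightarrow> (\<lambda>xs. inverse (f xs)) \<in> filt K N i n"
  by (auto simp: filt_iff cochain_inverse split: if_splits)

lemma one_filt [simp]: "(\<lambda>_. 1) \<in> filt K N i n"
  by (auto simp: filt_iff)

lemma subgroup_cochainsI:
  assumes "H \<subseteq> carrier (cochains K n)" "(\<lambda>_. 1) \<in> H"
    "\<And>f g. f \<in> H \<Longrightarrow> g \<in> H \<Longrightarrow> (\<lambda>xs. f xs * g xs) \<in> H"
    "\<And>f. f \<in> H \<Longrightarrow> (\<lambda>xs. inverse (f xs)) \<in> H"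
  shows "subgroup H (cochains K n)"
proof -
  interpret comm_group "cochains K n" by (rule comm_group_cochains)
  show ?thesis using assms by (intro subgroupI) (auto simp: inv_cochains subsetD)
qed

lemma mem_r_coset:
  "h \<in> H #>\<^bsub>cochains K n\<^esub> f \<longleftrightarrow> (\<exists>k\<in>H. h = (\<lambda>xs. k xs * f xs))"
  by (auto simp: r_coset_def)

lemma r_coset_mult:
  assumes "subgroup H (cochains K n)" "f \<in> carrier (cochains K n)" "k \<in> H"
  shows "H #>\<^bsub>cochains K n\<^esub> (\<lambda>xs. k xs * f xs) = H #>\<^bsub>cochains K n\<^esub> f"
proof -
  interpret comm_group "cochains K n" by (rule comm_group_cochains)
  show ?thesis
    by (rule repr_independence[symmetric]) (use assms in \<open>auto simp: mem_r_coset\<close>)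
qed

lemma r_coset_self:
  assumes "subgroup H (cochains K n)" shows "f \<in> H #>\<^bsub>cochains K n\<^esub> f"
  using subgroup.one_closed[OF assms] by (auto simp: mem_r_coset intro!: bexI[of _ "\<lambda>_. 1"])

text \<open>The total degree is a separate variable \<open>m\<close>, so that at bidegrees such as
  \<open>(1, n - 1)\<close> the cochains are directly in degree \<open>n\<close>.\<close>

lemma ss_Z_iff:
  "p + q = m \<Longrightarrow> f \<in> ss_Z K N r p q \<longleftrightarrow> f \<in> filt K N p m \<and> coboundary K m f \<in> filt K N (p + r) (m + 1)"
  by (auto simp: ss_Z_def)

lemma ss_B_iff:
  "p + q = m \<Longrightarrow> f \<in> ss_B K N r p q \<longleftrightarrow>
     f \<in> filt K N p m \<and> (\<exists>g\<in>filt K N (p - r + 1) (m - 1). f = coboundary K (m - 1) g)"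
  by (auto simp: ss_B_def)

lemma ss_denom_iff:
  "f \<in> ss_denom K N r p q \<longleftrightarrow>
     (\<exists>b\<in>ss_B K N r p q. \<exists>z\<in>ss_Z K N (r - 1) (p + 1) (q - 1). f = (\<lambda>xs. b xs * z xs))"
  by (auto simp: ss_denom_def set_mult_def)

text \<open>With this, multiplying by an element of the denominator does not change a coset
  (\<open>r_coset_mult\<close>), which underlies the well-definedness arguments on the
  pages.\<close>

lemma subgroup_ss_denom:
  assumes "p + q = m" shows "subgroup (ss_denom K N r p q) (cochains K m)"
proof (rule subgroup_cochainsI)
  have Z: "p + 1 + (q - 1) = m" using assms by simp
  note iffs = ss_B_iff[OF assms] ss_Z_iff[OF Z]
  show "ss_denom K N r p q \<subseteq> carrier (cochains K m)"
    using subsetD[OF filt_subset] by (auto simp: ss_denom_iff iffs intro!: cochain_mult)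
  have one: "(\<lambda>_. 1) \<in> ss_B K N r p q" "(\<lambda>_. 1) \<in> ss_Z K N (r - 1) (p + 1) (q - 1)"
    by (auto simp: iffs intro!: bexI[of _ "\<lambda>_. 1"])
  show "(\<lambda>_. 1) \<in> ss_denom K N r p q"
    using one unfolding ss_denom_iff by (intro bexI) auto
  fix f assume f: "f \<in> ss_denom K N r p q"
  then obtain b z where bz: "b \<in> ss_B K N r p q" "z \<in> ss_Z K N (r - 1) (p + 1) (q - 1)"
    "f = (\<lambda>xs. b xs * z xs)" by (auto simp: ss_denom_iff)
  then obtain a where a: "a \<in> filt K N (p - r + 1) (m - 1)" "b = coboundary K (m - 1) a"
    by (auto simp: iffs)
  show "(\<lambda>xs. inverse (f xs)) \<in> ss_denom K N r p q"
    unfolding ss_denom_iff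
  proof (intro bexI)
    show "(\<lambda>xs. inverse (b xs)) \<in> ss_B K N r p q"
      using bz(1) a unfolding iffs
      by (intro conjI bexI[of _ "\<lambda>xs. inverse (a xs)"]) (auto simp: filt_inverse coboundary_inverse)
    show "(\<lambda>xs. inverse (z xs)) \<in> ss_Z K N (r - 1) (p + 1) (q - 1)"
      using bz(2) by (simp add: iffs coboundary_inverse filt_inverse)
  qed (simp add: bz(3))
  fix g assume "g \<in> ss_denom K N r p q"
  then obtain b' z' where bz': "b' \<in> ss_B K N r p q" "z' \<in> ss_Z K N (r - 1) (p + 1) (q - 1)"
    "g = (\<lambda>xs. b' xs * z' xs)" by (auto simp: ss_denom_iff)
  then obtain a' where a': "a' \<in> filt K N (p - r + 1) (m - 1)" "b' = coboundary K (m - 1) a'"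
    by (auto simp: iffs)
  show "(\<lambda>xs. f xs * g xs) \<in> ss_denom K N r p q"
    unfolding ss_denom_iff
  proof (intro bexI)
    show "(\<lambda>xs. b xs * b' xs) \<in> ss_B K N r p q"
      using bz(1) bz'(1) a a' unfolding iffs
      by (intro conjI bexI[of _ "\<lambda>xs. a xs * a' xs"]) (auto simp: filt_mult coboundary_mult)
    show "(\<lambda>xs. z xs * z' xs) \<in> ss_Z K N (r - 1) (p + 1) (q - 1)"
      using bz(2) bz'(2) by (simp add: iffs coboundary_mult filt_mult)
  qed (simp add: bz(3) bz'(3) mult_ac)
qed

lemma carrier_ss_E:
  "X \<in> carrier (ss_E K N r p q) \<longleftrightarrow>
     (\<exists>f\<in>ss_Z K N r p q. X = ss_denom K N r p q #>\<^bsub>cochains K (p + q)\<^esub> f)"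
  by (auto simp: ss_E_def FactGroup_def RCOSETS_def r_coset_def)

lemma one_ss_E: "\<one>\<^bsub>ss_E K N r p q\<^esub> = ss_denom K N r p q"
  by (simp add: ss_E_def FactGroup_def)

lemma subgroup_coboundaries:
  assumes "group K" shows "subgroup (coboundaries K n) (cochains K n)"
proof (rule subgroup_cochainsI)
  show "coboundaries K n \<subseteq> carrier (cochains K n)"
    using coboundary_closed[OF assms, of _ "n - 1"] by (auto simp: coboundaries_def)
  show "(\<lambda>_. 1) \<in> coboundaries K n"
    by (auto simp: coboundaries_def intro!: image_eqI[of _ _ "\<lambda>_. 1"])
  show "(\<lambda>xs. f xs * g xs) \<in> coboundaries K n" if "f \<in> coboundaries K n" "g \<in> coboundaries K n" for f g
    using that cochain_mult[of _ K "n - 1"] by (auto simp: coboundaries_def coboundary_mult[symmetric])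
  show "(\<lambda>xs. inverse (f xs)) \<in> coboundaries K n" if "f \<in> coboundaries K n" for f
    using that cochain_inverse[of _ K "n - 1"] by (auto simp: coboundaries_def coboundary_inverse[symmetric])
qed

lemma coh_class_eq_iff:
  assumes "group K" "f \<in> carrier (cochains K n)"
  shows "coh_class K n f = coh_class K n g \<longleftrightarrow>
           (\<exists>\<beta>\<in>carrier (cochains K (n - 1)). g = (\<lambda>xs. coboundary K (n - 1) \<beta> xs * f xs))"
proof
  assume "coh_class K n f = coh_class K n g"
  then have "g \<in> coh_class K n f"
    unfolding coh_class_def using r_coset_self[OF subgroup_coboundaries[OF assms(1)]] by simp
  then show "\<exists>\<beta>\<in>carrier (cochains K (n - 1)). g = (\<lambda>xs. coboundary K (n - 1) \<beta> xs * f xs)"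
    by (auto simp: coh_class_def mem_r_coset coboundaries_def)
next
  assume "\<exists>\<beta>\<in>carrier (cochains K (n - 1)). g = (\<lambda>xs. coboundary K (n - 1) \<beta> xs * f xs)"
  then show "coh_class K n f = coh_class K n g"
    unfolding coh_class_def
    using r_coset_mult[OF subgroup_coboundaries[OF assms(1)] assms(2)] by (auto simp: coboundaries_def)
qed

section \<open>Group extensions: restriction to the subgroup and extension by one\<close>

locale group_extension =
  fixes D :: "'d monoid" and E :: "'e monoid" and G :: "'g monoid"
    and \<iota> :: "'d \<Rightarrow> 'e" and \<pi> :: "'e \<Rightarrow> 'g"
  assumes group_D: "group D" and group_E: "group E" and group_G: "group G"
    and \<iota>_hom: "\<iota> \<in> hom D E" and \<iota>_inj: "inj_on \<iota> (carrier D)"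
    and \<pi>_hom: "\<pi> \<in> hom E G" and \<pi>_surj: "\<pi> ` carrier E = carrier G"
    and exact: "\<iota> ` carrier D = kernel E G \<pi>"
begin

abbreviation N :: "'e set" where "N \<equiv> \<iota> ` carrier D"

lemma N_subset: "N \<subseteq> carrier E"
  using \<iota>_hom by (auto simp: hom_def)

lemma \<iota>_closed: "x \<in> carrier D \<Longrightarrow> \<iota> x \<in> carrier E"
  using \<iota>_hom by (auto simp: hom_def)

lemma \<pi>_closed: "x \<in> carrier E \<Longrightarrow> \<pi> x \<in> carrier G"
  using \<pi>_hom by (auto simp: hom_def)

lemma mem_N_iff: "x \<in> N \<longleftrightarrow> x \<in> carrier E \<and> \<pi> x = \<one>\<^bsub>G\<^esub>"
  by (auto simp: exact kernel_def)

lemma map_\<iota>_tuples: "xs \<in> tuples D n \<Longrightarrow> map \<iota> xs \<in> tuples E n"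
  by (auto simp: tuples_def \<iota>_closed subset_iff)

text \<open>A section of restriction to \<open>N\<close>. It is compatible with the coboundary on
  tuples from \<open>N\<close> (\<open>coboundary_extend\<close>) but in general not elsewhere, so a
  cocycle needs the finer \<open>lift\<close>.\<close>

definition extend :: "int \<Rightarrow> ('d list \<Rightarrow> complex) \<Rightarrow> ('e list \<Rightarrow> complex)" where
  "extend n \<beta> = (\<lambda>xs. if int (length xs) = n \<and> set xs \<subseteq> N then \<beta> (map (inv_into (carrier D) \<iota>) xs) else 1)"

lemma extend_map: "ds \<in> tuples D n \<Longrightarrow> extend n \<beta> (map \<iota> ds) = \<beta> ds"
  using \<iota>_inj by (auto simp: extend_def tuples_def subset_iff o_def intro!: arg_cong[of _ _ \<beta>] map_idI)

lemma list_in_N: "set xs \<subseteq> N \<Longrightarrow> \<exists>ds. set ds \<subseteq> carrier D \<and> xs = map \<iota> ds"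
  by (intro exI[of _ "map (inv_into (carrier D) \<iota>) xs"])
     (auto simp: subset_iff inv_into_into f_inv_into_f o_def intro!: map_idI[symmetric])

lemma extend_closed:
  assumes "\<beta> \<in> carrier (cochains D n)" shows "extend n \<beta> \<in> carrier (cochains E n)"
  unfolding carrier_cochains
proof (intro conjI ballI impI allI)
  fix xs
  show "cmod (extend n \<beta> xs) = 1" using cochain_norm[OF assms] by (simp add: extend_def)
  show "extend n \<beta> xs = 1" if "xs \<notin> tuples E n"
    using that N_subset by (auto simp: extend_def tuples_def)
  show "extend n \<beta> xs = 1" if "\<one>\<^bsub>E\<^esub> \<in> set xs"
  proof -
    have "inv_into (carrier D) \<iota> \<one>\<^bsub>E\<^esub> = \<one>\<^bsub>D\<^esub>"
      using \<iota>_inj hom_one[OF \<iota>_hom group_D group_E] group.is_monoid[OF group_D]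
      by (metis inv_into_f_f monoid.one_closed)
    then have "\<one>\<^bsub>D\<^esub> \<in> set (map (inv_into (carrier D) \<iota>) xs)"
      using that by (metis image_eqI set_map)
    then show ?thesis using cochain_one[OF assms] by (simp add: extend_def)
  qed
qed

lemma pullback_extend:
  assumes "\<beta> \<in> carrier (cochains D n)" shows "pullback D n \<iota> (extend n \<beta>) = \<beta>"
  using cochain_outside[OF assms] by (auto simp: pullback_def fun_eq_iff extend_map)

text \<open>Together with \<open>filt_of_pullback\<close> this identifies \<open>F^1\<close> with
  the kernel of restriction: for \<open>i = 1\<close> the threshold is \<open>n\<close>, so only the
  values on tuples from \<open>N\<close> are constrained.\<close>

lemma pullback_filt:
  assumes "z \<in> filt E N 1 n" shows "pullback D n \<iota> z = (\<lambda>_. 1)"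
proof (cases "n < 1")
  case False
  have "z (map \<iota> xs) = 1" if "xs \<in> tuples D n" for xs
  proof -
    have "{j. j < length (map \<iota> xs) \<and> map \<iota> xs ! j \<in> N} = {..<length xs}"
      using that by (auto simp: tuples_def intro!: imageI dest: subsetD[OF _ nth_mem])
    then show ?thesis
      using assms False map_\<iota>_tuples[OF that] that by (auto simp: filt_iff tuples_def)
  qed
  then show ?thesis by (auto simp: pullback_def)
qed (use assms in \<open>auto simp: filt_iff pullback_def\<close>)

lemma all_positions:
  assumes "length xs \<le> card {j. j < length xs \<and> xs ! j \<in> N}" shows "set xs \<subseteq> N"
proof -
  have *: "{j. j < length xs \<and> xs ! j \<in> N} = {..<length xs}"
    using assms by (intro card_seteq) auto
  have "xs ! i \<in> N" if "i < length xs" for i using * that by blast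
  then show ?thesis by (metis in_set_conv_nth subsetI)
qed

lemma filt_of_pullback:
  assumes "z \<in> carrier (cochains E n)" "pullback D n \<iota> z = (\<lambda>_. 1)"
  shows "z \<in> filt E N 1 n"
proof -
  have *: "z xs = 1" if xs: "xs \<in> tuples E n" "set xs \<subseteq> N" for xs
  proof -
    obtain ds where ds: "set ds \<subseteq> carrier D" "xs = map \<iota> ds" using list_in_N[OF xs(2)] by blast
    then have "ds \<in> tuples D n" using xs by (auto simp: tuples_def)
    then show ?thesis using fun_cong[OF assms(2), of ds] ds by (simp add: pullback_def)
  qed
  show ?thesis
  proof (cases "n < 1")
    \<comment> \<open>Here \<open>filt\<close> is trivial by definition. In degree 0 the only tuple
      is empty, thus a tuple from \<open>N\<close>, so its value is determined by
      restriction.\<close>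
    case True
    have "z xs = 1" for xs
    proof (cases "xs \<in> tuples E n")
      case True
      then have "xs = []" using \<open>n < 1\<close> by (cases xs) (auto simp: tuples_def)
      then show ?thesis using *[OF True] by simp
    qed (rule cochain_outside[OF assms(1)])
    then show ?thesis using True by (auto simp: filt_iff)
  next
    case False
    have "z xs = 1" if "xs \<in> tuples E n" "n \<le> int (card {j. j < length xs \<and> xs ! j \<in> N})" for xs
      using that by (intro * all_positions) (auto simp: tuples_def)
    then show ?thesis using False assms(1) by (simp add: filt_iff)
  qed
qed

section \<open>The edge map and the differentials leaving the column \<open>p = 0\<close>\<close>

lemma page_coset_cases:
  assumes "k \<in> ss_denom E N r 0 n"
  obtains b z where "b \<in> carrier (cochains E (n - 1))" "z \<in> filt E N 1 n"
    "coboundary E n z \<in> filt E N r (n + 1)" "k = (\<lambda>xs. coboundary E (n - 1) b xs * z xs)"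
proof -
  obtain b z where bz: "b \<in> filt E N (0 - r + 1) (n - 1)" "z \<in> filt E N 1 n"
    "coboundary E n z \<in> filt E N r (n + 1)" "k = (\<lambda>xs. coboundary E (n - 1) b xs * z xs)"
    using assms by (auto simp: ss_denom_iff ss_B_iff[of 0 n n] ss_Z_iff[of 1 "n - 1" n])
  show ?thesis by (rule that[OF subsetD[OF filt_subset bz(1)] bz(2-4)])
qed

text \<open>An element of the denominator is a coboundary times some \<open>z\<close> in
  \<open>F^1\<close>, which restricts to 1. So all representatives have cohomologous restrictions,
  and the \<open>the_elem\<close> in \<open>edge\<close> has a definite value.\<close>

lemma edge_coset:
  assumes "f \<in> carrier (cochains E n)"
  shows "edge D E \<iota> n (ss_denom E N r 0 n #>\<^bsub>cochains E n\<^esub> f) = coh_class D n (pullback D n \<iota> f)"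
proof -
  have "coh_class D n (pullback D n \<iota> h) = coh_class D n (pullback D n \<iota> f)"
    if h: "h \<in> ss_denom E N r 0 n #>\<^bsub>cochains E n\<^esub> f" for h
  proof -
    obtain k where k: "k \<in> ss_denom E N r 0 n" "h = (\<lambda>xs. k xs * f xs)"
      using h by (auto simp: mem_r_coset)
    obtain b z where b: "b \<in> carrier (cochains E (n - 1))" and z: "z \<in> filt E N 1 n"
        "coboundary E n z \<in> filt E N r (n + 1)" and k_eq: "k = (\<lambda>xs. coboundary E (n - 1) b xs * z xs)"
      by (rule page_coset_cases[OF k(1)])
    have "pullback D n \<iota> h
        = (\<lambda>xs. coboundary D (n - 1) (pullback D (n - 1) \<iota> b) xs * pullback D n \<iota> f xs)"
      using coboundary_pullback[OF group_D group_E \<iota>_hom b] 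
      unfolding k(2) k_eq pullback_mult pullback_filt[OF z(1)] by simp
    then show ?thesis
      using coh_class_eq_iff[OF group_D pullback_closed[OF group_D group_E \<iota>_hom assms], THEN iffD2,
          OF bexI[OF _ pullback_closed[OF group_D group_E \<iota>_hom b]]] by simp
  qed
  moreover have "ss_denom E N r 0 n #>\<^bsub>cochains E n\<^esub> f \<noteq> {}"
    using r_coset_self[OF subgroup_ss_denom[of 0 n n]] by fastforce
  ultimately show ?thesis unfolding edge_def by (rule the_elem_image_unique[rotated])
qed

text \<open>If the restrictions differ by the coboundary of \<open>\<beta>\<close>, extend
  \<open>\<beta>\<close> to \<open>b\<close>. The quotient of \<open>g\<close> by \<open>f\<close>
  and by the coboundary of \<open>b\<close> restricts trivially, hence lies in \<open>F^1\<close>,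
  and its coboundary is still in \<open>F^r\<close>. Since \<open>1 \<le> r\<close>, no filtration
  condition is imposed on \<open>b\<close>.\<close>

lemma edge_inj:
  assumes "1 \<le> r" "f \<in> ss_Z E N r 0 n" "g \<in> ss_Z E N r 0 n"
    and "coh_class D n (pullback D n \<iota> f) = coh_class D n (pullback D n \<iota> g)"
  shows "ss_denom E N r 0 n #>\<^bsub>cochains E n\<^esub> g = ss_denom E N r 0 n #>\<^bsub>cochains E n\<^esub> f"
proof -
  have f: "f \<in> carrier (cochains E n)" "coboundary E n f \<in> filt E N r (n + 1)"
    and g: "g \<in> carrier (cochains E n)" "coboundary E n g \<in> filt E N r (n + 1)"
    using assms(2,3) by (auto simp: ss_Z_iff[of 0 n n] filt_nonpos)
  obtain \<beta> where \<beta>: "\<beta> \<in> carrier (cochains D (n - 1))"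
    "pullback D n \<iota> g = (\<lambda>xs. coboundary D (n - 1) \<beta> xs * pullback D n \<iota> f xs)"
    using coh_class_eq_iff[OF group_D pullback_closed[OF group_D group_E \<iota>_hom f(1)], THEN iffD1, OF assms(4)]
    by blast
  define b where "b = extend (n - 1) \<beta>"
  have b: "b \<in> carrier (cochains E (n - 1))" "pullback D (n - 1) \<iota> b = \<beta>"
    using \<beta>(1) by (simp_all add: b_def extend_closed pullback_extend)
  have db: "coboundary E (n - 1) b \<in> carrier (cochains E n)"
    using coboundary_closed[OF group_E b(1)] by simp
  have ddb: "coboundary E n (coboundary E (n - 1) b) = (\<lambda>_. 1)"
    using coboundary_coboundary[OF group_E b(1)] by simp
  have pdb: "pullback D n \<iota> (coboundary E (n - 1) b) = coboundary D (n - 1) \<beta>"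
    using coboundary_pullback[OF group_D group_E \<iota>_hom b(1)] b(2) by simp
  define z where "z = (\<lambda>xs. (g xs * inverse (f xs)) * inverse (coboundary E (n - 1) b xs))"
  have z: "z \<in> carrier (cochains E n)"
    unfolding z_def by (intro cochain_mult cochain_inverse f g db)
  have "pullback D n \<iota> z = (\<lambda>_. 1)"
    using cochain_nonzero[OF pullback_closed[OF group_D group_E \<iota>_hom f(1)]]
      cochain_nonzero[OF coboundary_closed[OF group_D \<beta>(1)]]
    unfolding z_def pullback_mult pullback_inverse \<beta>(2) pdb by (simp add: field_simps)
  then have "z \<in> filt E N 1 n" using z by (rule filt_of_pullback[rotated])
  moreover have "coboundary E n z = (\<lambda>xs. coboundary E n g xs * inverse (coboundary E n f xs))"
    by (simp add: z_def coboundary_mult coboundary_inverse ddb)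
  then have "coboundary E n z \<in> filt E N r (n + 1)"
    using f g by (simp add: filt_mult filt_inverse)
  ultimately have "z \<in> ss_Z E N (r - 1) 1 (n - 1)" by (simp add: ss_Z_iff[of 1 "n - 1" n])
  moreover have "coboundary E (n - 1) b \<in> ss_B E N r 0 n"
    using assms(1) b db by (auto simp: ss_B_iff[of 0 n n] filt_nonpos)
  ultimately have "(\<lambda>xs. coboundary E (n - 1) b xs * z xs) \<in> ss_denom E N r 0 n"
    by (auto simp: ss_denom_iff)
  note r_coset_mult[OF subgroup_ss_denom[of 0 n n] f(1) this]
  moreover have "(\<lambda>xs. coboundary E (n - 1) b xs * z xs * f xs) = g"
    using cochain_nonzero[OF f(1)] cochain_nonzero[OF db] unfolding z_def by (simp add: field_simps)
  ultimately show ?thesis by simp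
qed

text \<open>Existence comes from \<open>edge_coset\<close>, uniqueness from \<open>edge_inj\<close>;
  the definite description in \<open>page_class\<close> can thus be evaluated on any suitable
  representative.\<close>

lemma page_class_eq:
  assumes "1 \<le> r" "f \<in> ss_Z E N r 0 n" "coh_class D n (pullback D n \<iota> f) = coh_class D n \<omega>"
  shows "page_class D E \<iota> n r \<omega> = ss_denom E N r 0 n #>\<^bsub>cochains E n\<^esub> f"
  unfolding page_class_def
proof (rule the_equality)
  have car: "h \<in> ss_Z E N r 0 n \<Longrightarrow> h \<in> carrier (cochains E n)" for h
    by (auto simp: ss_Z_iff[of 0 n n] filt_nonpos)
  show "ss_denom E N r 0 n #>\<^bsub>cochains E n\<^esub> f \<in> carrier (ss_E E N r 0 n) \<and>
    edge D E \<iota> n (ss_denom E N r 0 n #>\<^bsub>cochains E n\<^esub> f) = coh_class D n \<omega>"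
    using assms car by (auto simp: carrier_ss_E edge_coset)
  fix X assume X: "X \<in> carrier (ss_E E N r 0 n) \<and> edge D E \<iota> n X = coh_class D n \<omega>"
  then obtain g where g: "g \<in> ss_Z E N r 0 n" "X = ss_denom E N r 0 n #>\<^bsub>cochains E n\<^esub> g"
    by (auto simp: carrier_ss_E)
  then show "X = ss_denom E N r 0 n #>\<^bsub>cochains E n\<^esub> f"
    using edge_inj[OF assms(1,2) g(1)] X assms(3) car by (simp add: edge_coset)
qed

lemma ss_d_coset:
  assumes "f \<in> ss_Z E N r 0 n"
  shows "ss_d E N r 0 n (ss_denom E N r 0 n #>\<^bsub>cochains E n\<^esub> f)
           = ss_denom E N r r (n + 1 - r) #>\<^bsub>cochains E (n + 1)\<^esub> coboundary E n f"
proof -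
  let ?d = "\<lambda>h. ss_denom E N r r (n + 1 - r) #>\<^bsub>cochains E (n + 1)\<^esub> coboundary E n h"
  have sg: "subgroup (ss_denom E N r r (n + 1 - r)) (cochains E (n + 1))"
    by (rule subgroup_ss_denom) simp
  have f: "f \<in> carrier (cochains E n)"
    using assms by (auto simp: ss_Z_iff[of 0 n n] filt_nonpos)
  have "?d h = ?d f" if h: "h \<in> ss_denom E N r 0 n #>\<^bsub>cochains E n\<^esub> f" for h
  proof -
    obtain k where k: "k \<in> ss_denom E N r 0 n" "h = (\<lambda>xs. k xs * f xs)"
      using h by (auto simp: mem_r_coset)
    obtain b z where b: "b \<in> carrier (cochains E (n - 1))" and z: "z \<in> filt E N 1 n"
        "coboundary E n z \<in> filt E N r (n + 1)" and k_eq: "k = (\<lambda>xs. coboundary E (n - 1) b xs * z xs)"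
      by (rule page_coset_cases[OF k(1)])
    have dh: "coboundary E n h = (\<lambda>xs. coboundary E n z xs * coboundary E n f xs)"
      using coboundary_coboundary[OF group_E b] by (simp add: k(2) k_eq coboundary_mult)
    \<comment> \<open>For \<open>p = r\<close> the boundaries come from filtration
      \<open>p - r + 1 = 1\<close>, which is where \<open>z\<close> lives; so changing the
      representative changes the coboundary by an element of the target's denominator.\<close>
    have "coboundary E n z \<in> ss_B E N r r (n + 1 - r)"
      using z by (auto simp: ss_B_iff[of r "n + 1 - r" "n + 1"])
    moreover have "(\<lambda>_. 1) \<in> ss_Z E N (r - 1) (r + 1) (n + 1 - r - 1)"
      by (simp add: ss_Z_iff[of "r + 1" "n - r" "n + 1"])
    ultimately have "coboundary E n z \<in> ss_denom E N r r (n + 1 - r)"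
      unfolding ss_denom_iff by (intro bexI) auto
    then show ?thesis
      using r_coset_mult[OF sg coboundary_closed[OF group_E f]] by (simp add: dh)
  qed
  moreover have "ss_denom E N r 0 n #>\<^bsub>cochains E n\<^esub> f \<noteq> {}"
    using r_coset_self[OF subgroup_ss_denom[of 0 n n]] by fastforce
  ultimately have "the_elem (?d ` (ss_denom E N r 0 n #>\<^bsub>cochains E n\<^esub> f)) = ?d f"
    by (rule the_elem_image_unique[rotated])
  moreover have nr: "n - r + 1 = n + 1 - r" by simp
  ultimately show ?thesis by (simp add: ss_d_def nr)
qed

lemma lift_next_page:
  assumes "1 \<le> r" "f \<in> ss_Z E N r 0 n" "coh_class D n (pullback D n \<iota> f) = coh_class D n \<omega>"
    and "obstruction_vanishes D E \<iota> n \<omega> r"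
  shows "\<exists>f'\<in>ss_Z E N (r + 1) 0 n. coh_class D n (pullback D n \<iota> f') = coh_class D n \<omega>"
proof -
  have f: "f \<in> carrier (cochains E n)"
    using assms(2) by (auto simp: ss_Z_iff[of 0 n n] filt_nonpos)
  have "ss_denom E N r r (n + 1 - r) #>\<^bsub>cochains E (n + 1)\<^esub> coboundary E n f
          = ss_denom E N r r (n + 1 - r)"
    using assms(4) unfolding obstruction_vanishes_def page_class_eq[OF assms(1-3)] ss_d_coset[OF assms(2)]
      one_ss_E .
  then have "coboundary E n f \<in> ss_denom E N r r (n + 1 - r)"
    using r_coset_self[OF subgroup_ss_denom[of r "n + 1 - r" "n + 1" E N r]] by auto
  \<comment> \<open>The \<open>ss_B\<close> factor supplies \<open>g\<close> in filtration 1, the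
    \<open>ss_Z\<close> factor supplies \<open>z\<close> in filtration \<open>r + 1\<close>.\<close>
  then obtain g z where g: "g \<in> filt E N 1 n" and z: "z \<in> filt E N (r + 1) (n + 1)"
    and eq: "coboundary E n f = (\<lambda>xs. coboundary E n g xs * z xs)"
    by (auto simp: ss_denom_iff ss_B_iff[of r "n + 1 - r" "n + 1"]
        ss_Z_iff[of "r + 1" "n - r" "n + 1"])
  define f' where "f' = (\<lambda>xs. f xs * inverse (g xs))"
  have gc: "g \<in> carrier (cochains E n)" using g filt_subset by blast
  have "f' \<in> carrier (cochains E n)"
    unfolding f'_def by (intro cochain_mult cochain_inverse f gc)
  moreover have "coboundary E n f' = z"
    using cochain_nonzero[OF coboundary_closed[OF group_E gc]]
    by (auto simp: f'_def coboundary_mult coboundary_inverse eq)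
  ultimately have "f' \<in> ss_Z E N (r + 1) 0 n"
    using z by (simp add: ss_Z_iff[of 0 n n] filt_nonpos add.commute)
  moreover have "pullback D n \<iota> f' = pullback D n \<iota> f"
    by (simp add: f'_def pullback_mult pullback_inverse pullback_filt[OF g])
  ultimately show ?thesis using assms(3) by (intro bexI[of _ f']) auto
qed

lemma lift_page:
  assumes "f \<in> ss_Z E N 2 0 n" "coh_class D n (pullback D n \<iota> f) = coh_class D n \<omega>"
    and "\<And>i. 2 \<le> i \<Longrightarrow> i < r \<Longrightarrow> obstruction_vanishes D E \<iota> n \<omega> i" and "2 \<le> r"
  shows "\<exists>f\<in>ss_Z E N r 0 n. coh_class D n (pullback D n \<iota> f) = coh_class D n \<omega>"
  using assms(4,3)
proof (induction r rule: int_ge_induct)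
  case base
  show ?case using assms(1,2) by blast
next
  case (step r)
  have "\<exists>f\<in>ss_Z E N r 0 n. coh_class D n (pullback D n \<iota> f) = coh_class D n \<omega>"
    by (rule step.IH) (use step.prems in auto)
  then obtain f where "f \<in> ss_Z E N r 0 n" "coh_class D n (pullback D n \<iota> f) = coh_class D n \<omega>"
    by blast
  then show ?case using step.prems step.hyps by (intro lift_next_page[of r f]) auto
qed

text \<open>The pages see only the class of \<open>\<omega>\<close>. Multiplying by the coboundary
  of an extension of \<open>\<beta>\<close> makes the restriction equal to \<open>\<omega>\<close>
  itself and leaves the coboundary of the lift unchanged.\<close>

lemma lift_exact:
  assumes "f \<in> ss_Z E N r 0 n" "coh_class D n (pullback D n \<iota> f) = coh_class D n \<omega>"
  shows "\<exists>f\<in>ss_Z E N r 0 n. pullback D n \<iota> f = \<omega>"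
proof -
  have f: "f \<in> carrier (cochains E n)" "coboundary E n f \<in> filt E N r (n + 1)"
    using assms(1) by (auto simp: ss_Z_iff[of 0 n n] filt_nonpos)
  obtain \<beta> where \<beta>: "\<beta> \<in> carrier (cochains D (n - 1))"
    "\<omega> = (\<lambda>xs. coboundary D (n - 1) \<beta> xs * pullback D n \<iota> f xs)"
    using coh_class_eq_iff[OF group_D pullback_closed[OF group_D group_E \<iota>_hom f(1)], THEN iffD1, OF assms(2)]
    by blast
  define b where "b = extend (n - 1) \<beta>"
  have b: "b \<in> carrier (cochains E (n - 1))" "pullback D (n - 1) \<iota> b = \<beta>"
    using \<beta>(1) by (simp_all add: b_def extend_closed pullback_extend)
  define f' where "f' = (\<lambda>xs. coboundary E (n - 1) b xs * f xs)"
  have "f' \<in> carrier (cochains E n)"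
    unfolding f'_def using coboundary_closed[OF group_E b(1)] f by (intro cochain_mult) auto
  moreover have "coboundary E n f' = coboundary E n f"
    using coboundary_coboundary[OF group_E b(1)] by (simp add: f'_def coboundary_mult)
  moreover have "pullback D n \<iota> f' = \<omega>"
    using coboundary_pullback[OF group_D group_E \<iota>_hom b(1)] b(2) \<beta>(2) by (simp add: f'_def pullback_mult)
  ultimately show ?thesis
    using f by (intro bexI[of _ f']) (auto simp: ss_Z_iff[of 0 n n] filt_nonpos)
qed

end

section \<open>Cocycles inflated from the quotient\<close>

lemma powi_sign_eq:
  fixes a b :: complex
  assumes "a powi ((-1) ^ i) * b powi ((-1) ^ Suc i) = 1" "a \<noteq> 0" "b \<noteq> 0"
  shows "a = b"
  using assms by (cases "even i") (auto simp: field_simps power_int_minus)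

context group_extension
begin

sublocale E: group E by (rule group_E)
sublocale D: group D by (rule group_D)
sublocale G: group G by (rule group_G)
sublocale \<pi>: group_hom E G \<pi>
  using group_E group_G \<pi>_hom by (simp add: group_hom_def group_hom_axioms_def)
sublocale \<iota>: group_hom D E \<iota>
  using group_E group_D \<iota>_hom by (simp add: group_hom_def group_hom_axioms_def)

lemma quotient_mem_N_iff:
  "x \<in> carrier E \<Longrightarrow> y \<in> carrier E \<Longrightarrow> inv\<^bsub>E\<^esub> x \<otimes>\<^bsub>E\<^esub> y \<in> N \<longleftrightarrow> \<pi> y = \<pi> x"
  by (simp add: mem_N_iff) (metis G.inv_solve_left G.r_one \<pi>.hom_closed G.one_closed)

text \<open>Insert the product of \<open>p j\<close> and \<open>d\<close> as an additional vertex
  after \<open>p j\<close> and apply the cocycle condition to the larger simplex \<open>P\<close>.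
  The new entry \<open>d\<close> lies in \<open>N\<close> and survives in all faces except those
  omitting one of the two vertices around it; these are the two simplices to be compared.\<close>

lemma cocycle_shift_vertex:
  assumes c: "c \<in> carrier (cochains E (int m))" "coboundary E (int m) c = (\<lambda>_. 1)"
    and van: "\<And>xs. xs \<in> tuples E (int m) \<Longrightarrow> set xs \<inter> N \<noteq> {} \<Longrightarrow> c xs = 1"
    and p: "range p \<subseteq> carrier E" and j: "j \<le> m" and d: "d \<in> N"
  shows "c (diffs E m (p(j := p j \<otimes>\<^bsub>E\<^esub> d))) = c (diffs E m p)"
proof -
  define P where "P k = (if k \<le> j then p k else if k = Suc j then p j \<otimes>\<^bsub>E\<^esub> d else p (k - 1))" for k
  have dE: "d \<in> carrier E" using d N_subset by blast
  have pE: "p k \<in> carrier E" for k using p by auto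
  have P: "range P \<subseteq> carrier E" using pE dE by (auto simp: P_def)
  let ?t = "\<lambda>i. c (diffs E m (P \<circ> skip i)) powi ((-1) ^ i)"
  have entry: "inv\<^bsub>E\<^esub> (P j) \<otimes>\<^bsub>E\<^esub> P (Suc j) \<in> N"
    using d dE pE by (simp add: P_def E.m_assoc[symmetric])
  have "?t i = 1" if i: "i \<le> Suc m" "i \<noteq> j" "i \<noteq> Suc j" for i
  proof -
    have "inv\<^bsub>E\<^esub> (P j) \<otimes>\<^bsub>E\<^esub> P (Suc j) \<in> set (diffs E m (P \<circ> skip i))"
    proof (cases "i < j")
      case True
      then show ?thesis using j by (auto simp: set_diffs skip_def intro!: exI[of _ "j - 1"])
    next
      case False
      then show ?thesis using i by (auto simp: set_diffs skip_def intro!: exI[of _ j])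
    qed
    then have "c (diffs E m (P \<circ> skip i)) = 1"
      using entry by (intro van diffs_in_tuples[OF group_E range_comp_subset[OF P]]) blast
    then show ?thesis by simp
  qed
  then have "(\<Prod>i\<le>Suc m. ?t i) = (\<Prod>i\<in>{j, Suc j}. ?t i)"
    using j by (intro prod.mono_neutral_right) auto
  then have "?t j * ?t (Suc j) = 1"
    using fun_cong[OF c(2), of "diffs E (Suc m) P"] by (simp add: coboundary_diffs[OF group_E P] del: prod.atMost_Suc)
  then have "c (diffs E m (P \<circ> skip j)) = c (diffs E m (P \<circ> skip (Suc j)))"
    by (rule powi_sign_eq) (rule cochain_nonzero[OF c(1)])+
  also have "P \<circ> skip j = p(j := p j \<otimes>\<^bsub>E\<^esub> d)"
    by (auto simp: P_def skip_def fun_eq_iff)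
  also have "P \<circ> skip (Suc j) = p"
    by (auto simp: P_def skip_def fun_eq_iff)
  finally show ?thesis .
qed

text \<open>The vertices are exchanged one at a time; \<open>l\<close> counts those already taken
  from \<open>q\<close>.\<close>

lemma cocycle_coset_cong:
  assumes c: "c \<in> carrier (cochains E (int m))" "coboundary E (int m) c = (\<lambda>_. 1)"
    and van: "\<And>xs. xs \<in> tuples E (int m) \<Longrightarrow> set xs \<inter> N \<noteq> {} \<Longrightarrow> c xs = 1"
    and p: "range p \<subseteq> carrier E" and q: "range q \<subseteq> carrier E"
    and pq: "\<And>k. k \<le> m \<Longrightarrow> \<pi> (p k) = \<pi> (q k)"
  shows "c (diffs E m p) = c (diffs E m q)"
proof -
  have pE: "p k \<in> carrier E" and qE: "q k \<in> carrier E" for k using p q by auto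
  have "c (diffs E m (\<lambda>k. if k < l then q k else p k)) = c (diffs E m p)" if "l \<le> Suc m" for l
    using that
  proof (induction l)
    case 0
    then show ?case by simp
  next
    case (Suc l)
    let ?r = "\<lambda>k. if k < l then q k else p k"
    let ?d = "inv\<^bsub>E\<^esub> p l \<otimes>\<^bsub>E\<^esub> q l"
    have d: "?d \<in> N" using quotient_mem_N_iff[OF pE qE] pq[of l] Suc.prems by simp
    have r: "range ?r \<subseteq> carrier E" using pE qE by auto
    have "p l \<otimes>\<^bsub>E\<^esub> ?d = q l" using pE qE by (simp add: E.m_assoc[symmetric])
    then have "(\<lambda>k. if k < Suc l then q k else p k) = ?r(l := ?r l \<otimes>\<^bsub>E\<^esub> ?d)"
      by (auto simp: fun_eq_iff)
    then show ?case
      using cocycle_shift_vertex[OF c van r _ d, of l] Suc by simp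
  qed
  from this[of "Suc m"] have "c (diffs E m p) = c (diffs E m (\<lambda>k. if k < Suc m then q k else p k))" by simp
  also have "diffs E m (\<lambda>k. if k < Suc m then q k else p k) = diffs E m q"
    by (rule diffs_cong) simp
  finally show ?thesis .
qed

abbreviation \<sigma> :: "'g \<Rightarrow> 'e" where "\<sigma> \<equiv> inv_into (carrier E) \<pi>"

lemma \<sigma>_closed: "\<gamma> \<in> carrier G \<Longrightarrow> \<sigma> \<gamma> \<in> carrier E" and \<pi>_\<sigma>: "\<gamma> \<in> carrier G \<Longrightarrow> \<pi> (\<sigma> \<gamma>) = \<gamma>"
  using \<pi>_surj by (auto simp: inv_into_into f_inv_into_f)

lemma cocycle_inflated:
  assumes c: "c \<in> carrier (cochains E (int m))" "coboundary E (int m) c = (\<lambda>_. 1)"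
    and van: "\<And>xs. xs \<in> tuples E (int m) \<Longrightarrow> set xs \<inter> N \<noteq> {} \<Longrightarrow> c xs = 1"
  shows "\<exists>\<theta>\<in>cocycles G (int m). c = pullback E (int m) \<pi> \<theta>"
proof -
  define \<theta> where "\<theta> ys = (if ys \<in> tuples G (int m) then c (map \<sigma> ys) else 1)" for ys
  have map_\<pi>: "map \<pi> xs \<in> tuples G k" if "xs \<in> tuples E k" for xs k
    using that by (auto simp: tuples_def)
  have map_\<sigma>: "map \<sigma> ys \<in> tuples E k" if "ys \<in> tuples G k" for ys k
    using that \<sigma>_closed by (auto simp: tuples_def)
  \<comment> \<open>Both lists of vertices start at the unit, so equality of the images of the
    entries propagates to the cosets of all vertices.\<close>
  have eq: "c xs = c ys" if xs: "xs \<in> tuples E (int m)" and ys: "ys \<in> tuples E (int m)"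
    and xy: "map \<pi> xs = map \<pi> ys" for xs ys
  proof -
    obtain p where p: "range p \<subseteq> carrier E" "p 0 = \<one>\<^bsub>E\<^esub>" "xs = diffs E m p"
      by (rule tuples_diffsE[OF group_E E.one_closed xs])
    obtain q where q: "range q \<subseteq> carrier E" "q 0 = \<one>\<^bsub>E\<^esub>" "ys = diffs E m q"
      by (rule tuples_diffsE[OF group_E E.one_closed ys])
    have pE: "p k \<in> carrier E" and qE: "q k \<in> carrier E" for k using p q by auto
    have "\<pi> (p k) = \<pi> (q k)" if "k \<le> m" for k
      using that
    proof (induction k)
      case 0
      then show ?case by (simp add: p q)
    next
      case (Suc k)
      have "\<pi> (xs ! k) = \<pi> (ys ! k)"
        using arg_cong[OF xy, of "\<lambda>l. l ! k"] Suc.prems p q by simp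
      then show ?case using Suc pE qE by (simp add: p q)
    qed
    then show ?thesis using cocycle_coset_cong[OF c van p(1) q(1)] p q by simp
  qed
  have pull: "c = pullback E (int m) \<pi> \<theta>"
  proof
    fix xs
    have "c xs = c (map \<sigma> (map \<pi> xs))" if "xs \<in> tuples E (int m)"
      using that by (intro eq map_\<sigma> map_\<pi>) (auto simp: tuples_def \<pi>_\<sigma> subset_iff)
    then show "c xs = pullback E (int m) \<pi> \<theta> xs"
      using cochain_outside[OF c(1)] map_\<pi> by (simp add: pullback_def \<theta>_def)
  qed
  have \<theta>: "\<theta> \<in> carrier (cochains G (int m))"
    unfolding carrier_cochains
  proof (intro conjI ballI impI allI)
    fix ys assume ys: "ys \<in> tuples G (int m)"
    show "cmod (\<theta> ys) = 1" using cochain_norm[OF c(1)] by (simp add: \<theta>_def)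
    assume "\<one>\<^bsub>G\<^esub> \<in> set ys"
    \<comment> \<open>The representative of the trivial coset need not be the unit, so normalisation
      of \<open>c\<close> does not suffice; but it lies in \<open>N\<close>, where
      \<open>van\<close> applies.\<close>
    then have "\<sigma> \<one>\<^bsub>G\<^esub> \<in> set (map \<sigma> ys) \<inter> N" by (simp add: mem_N_iff \<sigma>_closed \<pi>_\<sigma>)
    then show "\<theta> ys = 1" using van[OF map_\<sigma>[OF ys]] ys by (auto simp: \<theta>_def)
  qed (simp add: \<theta>_def)
  have "coboundary G (int m) \<theta> ys = 1" for ys
  proof (cases "ys \<in> tuples G (int m + 1)")
    case True
    then have "map \<pi> (map \<sigma> ys) = ys" by (auto simp: tuples_def \<pi>_\<sigma> subset_iff intro!: map_idI)
    \<comment> \<open>Inflation is injective because \<pi> is onto: the value at \<open>ys\<close>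
      is read off at a lift of \<open>ys\<close>.\<close>
    then have "coboundary G (int m) \<theta> ys = pullback E (int m + 1) \<pi> (coboundary G (int m) \<theta>) (map \<sigma> ys)"
      using map_\<sigma>[OF True] by (simp add: pullback_def)
    also have "\<dots> = 1"
      unfolding coboundary_pullback[OF group_E group_G \<pi>_hom \<theta>, symmetric] pull[symmetric] c(2) ..
    finally show ?thesis .
  qed (rule coboundary_outside)
  then have "\<theta> \<in> cocycles G (int m)" using \<theta> by (auto simp: cocycles_iff)
  then show ?thesis using pull by blast
qed

end

section \<open>Lifting invariant classes to the second page\<close>

text \<open>Each vertex is the previous one times an entry, so a tuple fixes its vertices up to the
  choice of the first. A construction on vertices therefore descends to tuples if it is invariant
  under left translation, as \<open>vertex_lift\<close> will be.\<close>

lemma diffs_translate: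
  assumes "group K" "range p \<subseteq> carrier K" "range q \<subseteq> carrier K" "diffs K m p = diffs K m q" "j \<le> m"
  shows "q j = (q 0 \<otimes>\<^bsub>K\<^esub> inv\<^bsub>K\<^esub> p 0) \<otimes>\<^bsub>K\<^esub> p j"
proof -
  interpret group K by fact
  have pK: "p k \<in> carrier K" and qK: "q k \<in> carrier K" for k using assms by auto
  show ?thesis
    using assms(5)
  proof (induction j)
    case 0
    then show ?case using pK qK by (simp add: m_assoc)
  next
    case (Suc j)
    have "inv\<^bsub>K\<^esub> p j \<otimes>\<^bsub>K\<^esub> p (Suc j) = inv\<^bsub>K\<^esub> q j \<otimes>\<^bsub>K\<^esub> q (Suc j)"
      using arg_cong[OF assms(4), of "\<lambda>l. l ! j"] Suc.prems by simp
    moreover have "q (Suc j) = q j \<otimes>\<^bsub>K\<^esub> (inv\<^bsub>K\<^esub> q j \<otimes>\<^bsub>K\<^esub> q (Suc j))"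
      using qK by (simp add: m_assoc[symmetric])
    ultimately have "q (Suc j) = q j \<otimes>\<^bsub>K\<^esub> (inv\<^bsub>K\<^esub> p j \<otimes>\<^bsub>K\<^esub> p (Suc j))" by simp
    also have "\<dots> = (q 0 \<otimes>\<^bsub>K\<^esub> inv\<^bsub>K\<^esub> p 0) \<otimes>\<^bsub>K\<^esub> (p j \<otimes>\<^bsub>K\<^esub> (inv\<^bsub>K\<^esub> p j \<otimes>\<^bsub>K\<^esub> p (Suc j)))"
      using Suc pK qK by (simp add: m_assoc)
    also have "p j \<otimes>\<^bsub>K\<^esub> (inv\<^bsub>K\<^esub> p j \<otimes>\<^bsub>K\<^esub> p (Suc j)) = p (Suc j)"
      using pK by (simp add: m_assoc[symmetric])
    finally show ?case .
  qed
qed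

lemma diffs_left_mult:
  assumes "group K" "range p \<subseteq> carrier K" "g \<in> carrier K"
  shows "diffs K m (\<lambda>j. g \<otimes>\<^bsub>K\<^esub> p j) = diffs K m p"
proof -
  interpret group K by fact
  have pK: "p k \<in> carrier K" for k using assms by auto
  have "inv\<^bsub>K\<^esub> (g \<otimes>\<^bsub>K\<^esub> p j) \<otimes>\<^bsub>K\<^esub> (g \<otimes>\<^bsub>K\<^esub> p (Suc j)) = inv\<^bsub>K\<^esub> p j \<otimes>\<^bsub>K\<^esub> p (Suc j)" for j
  proof -
    have "inv\<^bsub>K\<^esub> g \<otimes>\<^bsub>K\<^esub> (g \<otimes>\<^bsub>K\<^esub> p (Suc j)) = p (Suc j)"
      using pK assms(3) by (simp add: m_assoc[symmetric])
    then show ?thesis using pK assms(3) by (simp add: inv_mult_group m_assoc)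
  qed
  then show ?thesis by (simp add: diffs_def)
qed

context group_extension
begin

lemma extend_outside: "\<not> set xs \<subseteq> N \<Longrightarrow> extend n \<beta> xs = 1"
  by (auto simp: extend_def)

lemma extend_one [simp]: "extend n (\<lambda>_. 1) = (\<lambda>_. 1)"
  by (auto simp: extend_def)

lemma diffs_in_N_iff:
  assumes "range p \<subseteq> carrier E"
  shows "set (diffs E m p) \<subseteq> N \<longleftrightarrow> (\<forall>j\<le>m. \<pi> (p j) = \<pi> (p 0))"
proof -
  have pE: "p k \<in> carrier E" for k using assms by auto
  have "set (diffs E m p) \<subseteq> N \<longleftrightarrow> (\<forall>j<m. \<pi> (p (Suc j)) = \<pi> (p j))"
    unfolding quotient_mem_N_iff[OF pE pE, symmetric] set_diffs by blast
  also have "\<dots> \<longleftrightarrow> (\<forall>j\<le>m. \<pi> (p j) = \<pi> (p 0))"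
  proof
    assume *: "\<forall>j<m. \<pi> (p (Suc j)) = \<pi> (p j)"
    have "j \<le> m \<Longrightarrow> \<pi> (p j) = \<pi> (p 0)" for j by (induction j) (use * in auto)
    then show "\<forall>j\<le>m. \<pi> (p j) = \<pi> (p 0)" by blast
  next
    assume *: "\<forall>j\<le>m. \<pi> (p j) = \<pi> (p 0)"
    then show "\<forall>j<m. \<pi> (p (Suc j)) = \<pi> (p j)" by (metis Suc_leI less_imp_le)
  qed
  finally show ?thesis .
qed

lemma tuples_in_N:
  assumes "xs \<in> tuples E n" "set xs \<subseteq> N"
  obtains ds where "ds \<in> tuples D n" "xs = map \<iota> ds"
  using list_in_N[OF assms(2)] assms(1) by (auto simp: tuples_def)

lemma coboundary_extend:
  assumes "\<beta> \<in> carrier (cochains D n)" "ds \<in> tuples D (n + 1)"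
  shows "coboundary E n (extend n \<beta>) (map \<iota> ds) = coboundary D n \<beta> ds"
proof -
  have "coboundary D n \<beta> = pullback D (n + 1) \<iota> (coboundary E n (extend n \<beta>))"
    using coboundary_pullback[OF group_D group_E \<iota>_hom extend_closed[OF assms(1)]]
    unfolding pullback_extend[OF assms(1)] .
  then show ?thesis using assms(2) by (simp add: pullback_def)
qed

section \<open>Conjugation and invariance of the class\<close>

lemma \<iota>_conj_aut:
  assumes "h \<in> carrier E" "d \<in> carrier D"
  shows "conj_aut D E \<iota> h d \<in> carrier D" "\<iota> (conj_aut D E \<iota> h d) = inv\<^bsub>E\<^esub> h \<otimes>\<^bsub>E\<^esub> \<iota> d \<otimes>\<^bsub>E\<^esub> h"
proof -
  have "\<pi> (\<iota> d) = \<one>\<^bsub>G\<^esub>" using assms(2) mem_N_iff by blast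
  then have "inv\<^bsub>E\<^esub> h \<otimes>\<^bsub>E\<^esub> \<iota> d \<otimes>\<^bsub>E\<^esub> h \<in> N"
    using assms by (simp add: mem_N_iff)
  then show "conj_aut D E \<iota> h d \<in> carrier D" "\<iota> (conj_aut D E \<iota> h d) = inv\<^bsub>E\<^esub> h \<otimes>\<^bsub>E\<^esub> \<iota> d \<otimes>\<^bsub>E\<^esub> h"
    by (simp_all add: conj_aut_def inv_into_into f_inv_into_f)
qed

lemma conj_aut_hom:
  assumes "h \<in> carrier E" shows "conj_aut D E \<iota> h \<in> hom D D"
proof (rule homI)
  fix x y assume xy: "x \<in> carrier D" "y \<in> carrier D"
  have "h \<otimes>\<^bsub>E\<^esub> (inv\<^bsub>E\<^esub> h \<otimes>\<^bsub>E\<^esub> (\<iota> y \<otimes>\<^bsub>E\<^esub> h)) = \<iota> y \<otimes>\<^bsub>E\<^esub> h"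
    using assms xy by (simp add: E.m_assoc[symmetric])
  then have "\<iota> (conj_aut D E \<iota> h (x \<otimes>\<^bsub>D\<^esub> y)) = \<iota> (conj_aut D E \<iota> h x \<otimes>\<^bsub>D\<^esub> conj_aut D E \<iota> h y)"
    using assms xy by (simp add: \<iota>_conj_aut E.m_assoc)
  then show "conj_aut D E \<iota> h (x \<otimes>\<^bsub>D\<^esub> y) = conj_aut D E \<iota> h x \<otimes>\<^bsub>D\<^esub> conj_aut D E \<iota> h y"
    using assms xy by (intro inj_onD[OF \<iota>_inj]) (auto simp: \<iota>_conj_aut)
qed (use assms in \<open>auto simp: \<iota>_conj_aut\<close>)

text \<open>Cohomologous cochains have cohomologous conjugates, so the \<open>the_elem\<close> in
  \<open>coh_action\<close> is the class of the conjugate of \<open>\<omega>\<close>; invariance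
  then yields the correcting cochain \<open>\<eta>\<close>.\<close>

lemma invariant_class_conj:
  assumes \<omega>: "\<omega> \<in> carrier (cochains D n)"
    and inv: "coh_class D n \<omega> \<in> coh_invariants D E G \<iota> \<pi> n" and \<gamma>: "\<gamma> \<in> carrier G"
  shows "\<exists>\<eta>\<in>carrier (cochains D (n - 1)).
    pullback D n (conj_aut D E \<iota> (\<sigma> \<gamma>)) \<omega> = (\<lambda>xs. coboundary D (n - 1) \<eta> xs * \<omega> xs)"
proof -
  let ?c = "conj_aut D E \<iota> (\<sigma> \<gamma>)"
  have c: "?c \<in> hom D D" by (rule conj_aut_hom[OF \<sigma>_closed[OF \<gamma>]])
  note pc = pullback_closed[OF group_D group_D c]
  have "coh_class D n (pullback D n ?c f) = coh_class D n (pullback D n ?c \<omega>)"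
    if f: "f \<in> coh_class D n \<omega>" for f
  proof -
    obtain \<beta> where \<beta>: "\<beta> \<in> carrier (cochains D (n - 1))" "f = (\<lambda>xs. coboundary D (n - 1) \<beta> xs * \<omega> xs)"
      using f by (auto simp: coh_class_def mem_r_coset coboundaries_def)
    have "pullback D n ?c f
        = (\<lambda>xs. coboundary D (n - 1) (pullback D (n - 1) ?c \<beta>) xs * pullback D n ?c \<omega> xs)"
      using coboundary_pullback[OF group_D group_D c \<beta>(1)] by (simp add: \<beta>(2) pullback_mult)
    then show ?thesis
      using coh_class_eq_iff[OF group_D pc[OF \<omega>], THEN iffD2, OF bexI[OF _ pc[OF \<beta>(1)]]] by simp
  qed
  moreover have "coh_class D n \<omega> \<noteq> {}"
    using r_coset_self[OF subgroup_coboundaries[OF group_D]] unfolding coh_class_def by fastforce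
  ultimately have "coh_action D E \<iota> \<pi> n \<gamma> (coh_class D n \<omega>) = coh_class D n (pullback D n ?c \<omega>)"
    unfolding coh_action_def by (rule the_elem_image_unique[rotated])
  then have "coh_class D n \<omega> = coh_class D n (pullback D n ?c \<omega>)"
    using inv \<gamma> by (simp add: coh_invariants_def)
  then show ?thesis by (rule coh_class_eq_iff[OF group_D \<omega>, THEN iffD1])
qed

end

text \<open>The degree is \<open>Suc m\<close>, so that each \<open>\<eta> \<gamma>\<close> has
  natural degree \<open>m\<close>. Normalising \<open>s\<close> and \<open>\<eta>\<close> at the
  unit makes the lift restrict to \<open>\<omega>\<close> exactly and keeps it a normalised
  cochain.\<close>

locale invariant_cocycle = group_extension D E G \<iota> \<pi>
  for D :: "'d monoid" and E :: "'e monoid" and G :: "'g monoid" and \<iota> and \<pi> +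
  fixes m :: nat and \<omega> :: "'d list \<Rightarrow> complex"
    and s :: "'g \<Rightarrow> 'e" and \<eta> :: "'g \<Rightarrow> 'd list \<Rightarrow> complex"
  assumes \<omega>: "\<omega> \<in> carrier (cochains D (int (Suc m)))" "coboundary D (int (Suc m)) \<omega> = (\<lambda>_. 1)"
    and s: "\<gamma> \<in> carrier G \<Longrightarrow> s \<gamma> \<in> carrier E" "\<gamma> \<in> carrier G \<Longrightarrow> \<pi> (s \<gamma>) = \<gamma>" "s \<one>\<^bsub>G\<^esub> = \<one>\<^bsub>E\<^esub>"
    and \<eta>: "\<gamma> \<in> carrier G \<Longrightarrow> \<eta> \<gamma> \<in> carrier (cochains D (int m))" "\<eta> \<one>\<^bsub>G\<^esub> = (\<lambda>_. 1)"
    and conj: "\<gamma> \<in> carrier G \<Longrightarrow> pullback D (int (Suc m)) (conj_aut D E \<iota> (s \<gamma>)) \<omega>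
                 = (\<lambda>xs. coboundary D (int m) (\<eta> \<gamma>) xs * \<omega> xs)"
begin

abbreviation W :: "'e list \<Rightarrow> complex" where "W \<equiv> extend (int (Suc m)) \<omega>"
abbreviation H :: "'g \<Rightarrow> 'e list \<Rightarrow> complex" where "H \<gamma> \<equiv> extend (int m) (\<eta> \<gamma>)"

text \<open>For vertices in more than two cosets of \<open>N\<close>, \<open>vertex_lift\<close> has no meaning beyond being
  normalised; its coboundary is only computed on simplices with at most two.\<close>

definition end_class :: "(nat \<Rightarrow> 'e) \<Rightarrow> 'g" where
  "end_class p = inv\<^bsub>G\<^esub> (\<pi> (p 0)) \<otimes>\<^bsub>G\<^esub> \<pi> (p (Suc m))"

text \<open>Right multiplication commutes with left translation of the vertices and, as
  \<open>N\<close> is normal, permutes its cosets.\<close>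

definition twist :: "(nat \<Rightarrow> 'e) \<Rightarrow> nat \<Rightarrow> 'e" where
  "twist p j = p j \<otimes>\<^bsub>E\<^esub> (if \<pi> (p j) = \<pi> (p 0) then s (end_class p) else \<one>\<^bsub>E\<^esub>)"

text \<open>The factor \<open>H\<close> ignores the last vertex and is 1 unless all other vertices
  share a coset. Its exponent is such that over the faces of a larger simplex it produces the
  coboundary of \<open>H\<close> that cancels the discrepancy on the last face.\<close>

definition vertex_lift :: "(nat \<Rightarrow> 'e) \<Rightarrow> complex" where
  "vertex_lift p = W (diffs E (Suc m) (twist p)) * H (end_class p) (diffs E m p) powi ((-1) ^ m)"

definition lift :: "'e list \<Rightarrow> complex" where
  "lift xs = (if xs \<in> tuples E (int (Suc m))
     then vertex_lift (SOME p. range p \<subseteq> carrier E \<and> xs = diffs E (Suc m) p) else 1)"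

lemma end_class_closed: "range p \<subseteq> carrier E \<Longrightarrow> end_class p \<in> carrier G"
  by (auto simp: end_class_def image_subset_iff)

lemma twist_closed: "range p \<subseteq> carrier E \<Longrightarrow> range (twist p) \<subseteq> carrier E"
  using end_class_closed[of p] s(1) by (auto simp: twist_def image_subset_iff)

lemma W_closed: "W \<in> carrier (cochains E (int (Suc m)))"
  by (rule extend_closed[OF \<omega>(1)])

lemma H_closed: "\<gamma> \<in> carrier G \<Longrightarrow> H \<gamma> \<in> carrier (cochains E (int m))"
  by (rule extend_closed[OF \<eta>(1)])

text \<open>Two lists of vertices for one tuple differ by a left translation \<open>g\<close>;
  \<open>end_class\<close> is invariant under it and \<open>twist\<close> is equivariant. So the
  choice of vertices in \<open>lift\<close> is immaterial.\<close>

lemma vertex_lift_cong: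
  assumes p: "range p \<subseteq> carrier E" and q: "range q \<subseteq> carrier E"
    and eq: "diffs E (Suc m) p = diffs E (Suc m) q"
  shows "vertex_lift p = vertex_lift q"
proof -
  have pE: "p k \<in> carrier E" and qE: "q k \<in> carrier E" for k using p q by auto
  define g where "g = q 0 \<otimes>\<^bsub>E\<^esub> inv\<^bsub>E\<^esub> p 0"
  have g: "g \<in> carrier E" using pE qE by (simp add: g_def)
  have qg: "q j = g \<otimes>\<^bsub>E\<^esub> p j" if "j \<le> Suc m" for j
    unfolding g_def by (rule diffs_translate[OF group_E p q eq that])
  have "inv\<^bsub>G\<^esub> \<pi> g \<otimes>\<^bsub>G\<^esub> (\<pi> g \<otimes>\<^bsub>G\<^esub> \<pi> (p (Suc m))) = \<pi> (p (Suc m))"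
    using g pE by (simp add: G.m_assoc[symmetric])
  then have ec: "end_class q = end_class p"
    using qg[of 0] qg[of "Suc m"] g pE by (simp add: end_class_def G.inv_mult_group G.m_assoc)
  have "diffs E (Suc m) (twist q) = diffs E (Suc m) (\<lambda>j. g \<otimes>\<^bsub>E\<^esub> twist p j)"
    using g pE s(1) end_class_closed[OF p]
    by (intro diffs_cong) (auto simp: twist_def ec qg E.m_assoc)
  also have "\<dots> = diffs E (Suc m) (twist p)"
    by (rule diffs_left_mult[OF group_E twist_closed[OF p] g])
  finally have "diffs E (Suc m) (twist q) = diffs E (Suc m) (twist p)" .
  moreover have "diffs E m q = diffs E m (\<lambda>j. g \<otimes>\<^bsub>E\<^esub> p j)"
    by (rule diffs_cong) (simp add: qg)
  then have "diffs E m q = diffs E m p"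
    using diffs_left_mult[OF group_E p g] by simp
  ultimately show ?thesis by (simp add: vertex_lift_def ec)
qed

lemma lift_diffs:
  assumes "range p \<subseteq> carrier E" shows "lift (diffs E (Suc m) p) = vertex_lift p"
proof -
  let ?P = "\<lambda>q. range q \<subseteq> carrier E \<and> diffs E (Suc m) p = diffs E (Suc m) q"
  have P: "?P (SOME q. ?P q)" by (rule someI[of ?P p]) (use assms in simp)
  have "vertex_lift (SOME q. ?P q) = vertex_lift p"
    by (rule vertex_lift_cong[OF conjunct1[OF P] assms conjunct2[OF P, symmetric]])
  then show ?thesis unfolding lift_def using diffs_in_tuples[OF group_E assms, of "Suc m"] by simp
qed

text \<open>With one coset only, \<open>end_class\<close> is the unit, where \<open>s\<close> and
  \<open>\<eta>\<close> are trivial.\<close>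

lemma vertex_lift_constant:
  assumes "range p \<subseteq> carrier E" "\<And>j. j \<le> Suc m \<Longrightarrow> \<pi> (p j) = \<pi> (p 0)"
  shows "vertex_lift p = W (diffs E (Suc m) p)"
proof -
  have pE: "p k \<in> carrier E" for k using assms by auto
  have "end_class p = \<one>\<^bsub>G\<^esub>" using assms(2)[of "Suc m"] pE by (simp add: end_class_def)
  moreover from this have "diffs E (Suc m) (twist p) = diffs E (Suc m) p"
    by (intro diffs_cong) (simp add: twist_def s pE)
  ultimately show ?thesis by (simp add: vertex_lift_def \<eta>)
qed

lemma lift_closed: "lift \<in> carrier (cochains E (int (Suc m)))"
  unfolding carrier_cochains
proof (intro conjI ballI impI allI)
  fix xs assume "xs \<in> tuples E (int (Suc m))"
  then obtain p where p: "range p \<subseteq> carrier E" and xs: "xs = diffs E (Suc m) p"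
    using tuples_diffsE[OF group_E E.one_closed] by metis
  have pE: "p k \<in> carrier E" for k using p by auto
  note ec = end_class_closed[OF p]
  show "cmod (lift xs) = 1"
    using cochain_norm[OF W_closed] cochain_norm[OF H_closed[OF ec]]
    by (simp add: xs lift_diffs[OF p] vertex_lift_def norm_mult norm_power_int)
  assume "\<one>\<^bsub>E\<^esub> \<in> set xs"
  then obtain j where j: "j < Suc m" "\<one>\<^bsub>E\<^esub> = inv\<^bsub>E\<^esub> p j \<otimes>\<^bsub>E\<^esub> p (Suc j)"
    by (auto simp: xs set_diffs)
  moreover have "p (Suc j) = p j \<otimes>\<^bsub>E\<^esub> (inv\<^bsub>E\<^esub> p j \<otimes>\<^bsub>E\<^esub> p (Suc j))"
    using pE by (simp add: E.m_assoc[symmetric])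
  ultimately have pj: "p (Suc j) = p j" using pE by (metis E.r_one)
  have "W (diffs E (Suc m) (twist p)) = 1"
    by (rule cochain_diffs_one[OF group_E twist_closed[OF p] W_closed j(1)]) (simp add: twist_def pj)
  moreover have "H (end_class p) (diffs E m p) = 1"
  proof (cases "j < m")
    case True
    show ?thesis by (rule cochain_diffs_one[OF group_E p H_closed[OF ec] True]) (simp add: pj)
  next
    case False
    \<comment> \<open>Now the repetition involves the vertex that \<open>H\<close> ignores. Either
      the other vertices meet several cosets and \<open>H\<close> is 1 there, or all vertices lie in
      one coset and \<open>end_class\<close> is the unit.\<close>
    then have "j = m" using j by simp
    show ?thesis
    proof (cases "set (diffs E m p) \<subseteq> N")
      case True
      then have "\<pi> (p m) = \<pi> (p 0)" using diffs_in_N_iff[OF p, of m] by blast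
      then have "\<pi> (p (Suc m)) = \<pi> (p 0)" using pj \<open>j = m\<close> by simp
      then have "end_class p = \<one>\<^bsub>G\<^esub>" using pE by (simp add: end_class_def)
      then show ?thesis by (simp add: \<eta>)
    qed (rule extend_outside)
  qed
  ultimately show "lift xs = 1" by (simp add: xs lift_diffs[OF p] vertex_lift_def)
qed (simp add: lift_def)

lemma pullback_lift: "pullback D (int (Suc m)) \<iota> lift = \<omega>"
proof
  fix ds
  have "lift (map \<iota> ds) = \<omega> ds" if ds: "ds \<in> tuples D (int (Suc m))"
  proof -
    obtain p where p: "range p \<subseteq> carrier E" and xs: "map \<iota> ds = diffs E (Suc m) p"
      using tuples_diffsE[OF group_E E.one_closed map_\<iota>_tuples[OF ds]] by metis
    have "set (map \<iota> ds) \<subseteq> N" using ds by (auto simp: tuples_def)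
    then have "lift (map \<iota> ds) = W (map \<iota> ds)"
      unfolding xs lift_diffs[OF p] using diffs_in_N_iff[OF p] by (intro vertex_lift_constant[OF p]) blast
    then show ?thesis by (simp only: extend_map[OF ds])
  qed
  then show "pullback D (int (Suc m)) \<iota> lift ds = \<omega> ds"
    using cochain_outside[OF \<omega>(1)] by (simp add: pullback_def)
qed

lemma coboundary_W:
  assumes "xs \<in> tuples E (int (Suc (Suc m)))" "set xs \<subseteq> N"
  shows "coboundary E (int (Suc m)) W xs = 1"
proof -
  obtain ds where ds: "ds \<in> tuples D (int (Suc (Suc m)))" "xs = map \<iota> ds"
    using tuples_in_N[OF assms] by blast
  then show ?thesis using coboundary_extend[OF \<omega>(1), of ds] \<omega>(2) by (simp add: add.commute)
qed

text \<open>Right translation by \<open>s \<gamma>\<close> conjugates every entry, so the left side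
  is the conjugate of \<open>\<omega>\<close> at the original tuple, which \<open>conj\<close>
  expresses through \<open>\<eta> \<gamma>\<close>.\<close>

lemma W_translate:
  assumes p: "range p \<subseteq> carrier E" and const: "\<And>j. j \<le> Suc m \<Longrightarrow> \<pi> (p j) = \<pi> (p 0)"
    and \<gamma>: "\<gamma> \<in> carrier G"
  shows "W (diffs E (Suc m) (\<lambda>j. p j \<otimes>\<^bsub>E\<^esub> s \<gamma>))
           = coboundary E (int m) (H \<gamma>) (diffs E (Suc m) p) * W (diffs E (Suc m) p)"
proof -
  have pE: "p k \<in> carrier E" for k using p by auto
  have "set (diffs E (Suc m) p) \<subseteq> N" using diffs_in_N_iff[OF p] const by blast
  then obtain ds where ds: "ds \<in> tuples D (int (Suc m))" "diffs E (Suc m) p = map \<iota> ds"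
    using tuples_in_N[OF diffs_in_tuples[OF group_E p]] by metis
  then have len: "length ds = Suc m" and dD: "j < Suc m \<Longrightarrow> ds ! j \<in> carrier D" for j
    by (auto simp: tuples_def dest: subsetD[OF _ nth_mem])
  let ?c = "conj_aut D E \<iota> (s \<gamma>)"
  have cds: "map ?c ds \<in> tuples D (int (Suc m))"
    using ds(1) \<iota>_conj_aut[OF s(1)[OF \<gamma>]] by (auto simp: tuples_def)
  have "diffs E (Suc m) (\<lambda>j. p j \<otimes>\<^bsub>E\<^esub> s \<gamma>) = map \<iota> (map ?c ds)"
  proof (rule nth_equalityI)
    fix j assume "j < length (diffs E (Suc m) (\<lambda>j. p j \<otimes>\<^bsub>E\<^esub> s \<gamma>))"
    then have j: "j < Suc m" by simp
    have "\<iota> (ds ! j) = inv\<^bsub>E\<^esub> p j \<otimes>\<^bsub>E\<^esub> p (Suc j)"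
      using arg_cong[OF ds(2), of "\<lambda>l. l ! j"] j len by simp
    then show "diffs E (Suc m) (\<lambda>j. p j \<otimes>\<^bsub>E\<^esub> s \<gamma>) ! j = map \<iota> (map ?c ds) ! j"
      using j len pE s(1)[OF \<gamma>] \<iota>_conj_aut(2)[OF s(1)[OF \<gamma>] dD[OF j]]
      by (simp add: E.inv_mult_group E.m_assoc)
  qed (simp add: len)
  then have "W (diffs E (Suc m) (\<lambda>j. p j \<otimes>\<^bsub>E\<^esub> s \<gamma>)) = \<omega> (map ?c ds)"
    by (simp only: extend_map[OF cds])
  also have "\<dots> = coboundary D (int m) (\<eta> \<gamma>) ds * \<omega> ds"
    using fun_cong[OF conj[OF \<gamma>], of ds] ds(1) by (simp add: pullback_def)
  also have "\<dots> = coboundary E (int m) (H \<gamma>) (map \<iota> ds) * W (map \<iota> ds)"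
    using coboundary_extend[OF \<eta>(1)[OF \<gamma>], of ds] extend_map[OF ds(1)] ds(1) by (simp add: add.commute)
  finally show ?thesis by (simp only: ds(2))
qed

lemma coboundary_lift_constant:
  assumes p: "range p \<subseteq> carrier E" and const: "\<And>j. j \<le> Suc (Suc m) \<Longrightarrow> \<pi> (p j) = \<pi> (p 0)"
  shows "coboundary E (int (Suc m)) lift (diffs E (Suc (Suc m)) p) = 1"
proof -
  have "lift (diffs E (Suc m) (p \<circ> skip i)) = W (diffs E (Suc m) (p \<circ> skip i))" for i
  proof -
    have c: "\<pi> ((p \<circ> skip i) j) = \<pi> (p 0)" if "j \<le> Suc m" for j
      using const[of "skip i j"] that by (simp add: skip_def)
    have "\<pi> ((p \<circ> skip i) j) = \<pi> ((p \<circ> skip i) 0)" if "j \<le> Suc m" for j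
      by (rule trans[OF c[OF that] c[OF le0, symmetric]])
    then show ?thesis
      unfolding lift_diffs[OF range_comp_subset[OF p]]
      by (intro vertex_lift_constant[OF range_comp_subset[OF p]])
  qed
  then have "coboundary E (int (Suc m)) lift (diffs E (Suc (Suc m)) p)
      = coboundary E (int (Suc m)) W (diffs E (Suc (Suc m)) p)"
    by (simp only: coboundary_diffs[OF group_E p])
  also have "\<dots> = 1"
    using diffs_in_N_iff[OF p, of "Suc (Suc m)"] const
    by (intro coboundary_W diffs_in_tuples[OF group_E p]) blast
  finally show ?thesis .
qed

text \<open>Translating the vertices up to \<open>a\<close> by \<open>s \<gamma>\<close> gives a
  simplex \<open>Q\<close> in a single coset, where the cocycle condition for
  \<open>\<omega>\<close> applies. On each face \<open>lift\<close> is the value of \<open>W\<close>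
  on that face of \<open>Q\<close> times an error \<open>e i\<close>, and the alternating product of
  the errors is 1.\<close>

lemma coboundary_lift_break:
  assumes p: "range p \<subseteq> carrier E" and a: "a \<le> Suc m"
    and c0: "\<And>j. j \<le> a \<Longrightarrow> \<pi> (p j) = c0"
    and c1: "\<And>j. a < j \<Longrightarrow> j \<le> Suc (Suc m) \<Longrightarrow> \<pi> (p j) = c1"
    and ne: "c0 \<noteq> c1"
  shows "coboundary E (int (Suc m)) lift (diffs E (Suc (Suc m)) p) = 1"
proof -
  have pE: "p k \<in> carrier E" for k using p by auto
  have c0G: "c0 \<in> carrier G" using c0[of 0] pE[of 0] \<pi>_closed by auto
  have c1G: "c1 \<in> carrier G" using c1[of "Suc (Suc m)"] pE[of "Suc (Suc m)"] \<pi>_closed a by auto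
  define \<gamma> where "\<gamma> = inv\<^bsub>G\<^esub> c0 \<otimes>\<^bsub>G\<^esub> c1"
  have \<gamma>: "\<gamma> \<in> carrier G" using c0G c1G by (simp add: \<gamma>_def)
  have sE: "s \<gamma> \<in> carrier E" using s(1)[OF \<gamma>] .
  have c0\<gamma>: "c0 \<otimes>\<^bsub>G\<^esub> \<gamma> = c1" using c0G c1G by (simp add: \<gamma>_def G.m_assoc[symmetric])
  define Q where "Q j = p j \<otimes>\<^bsub>E\<^esub> (if j \<le> a then s \<gamma> else \<one>\<^bsub>E\<^esub>)" for j
  have Q: "range Q \<subseteq> carrier E" using pE sE by (auto simp: Q_def)
  have \<pi>Q: "\<pi> (Q j) = c1" if "j \<le> Suc (Suc m)" for j
    using that c0[of j] c1[of j] pE sE s(2)[OF \<gamma>] c0\<gamma> c1G by (auto simp: Q_def)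
  have "set (diffs E (Suc (Suc m)) Q) \<subseteq> N"
    using diffs_in_N_iff[OF Q] \<pi>Q by (metis zero_le)
  then have dW: "coboundary E (int (Suc m)) W (diffs E (Suc (Suc m)) Q) = 1"
    by (rule coboundary_W[OF diffs_in_tuples[OF group_E Q]])
  define h where "h i = H \<gamma> (diffs E m (p \<circ> skip i))" for i
  have h0: "h i \<noteq> 0" for i unfolding h_def by (rule cochain_nonzero[OF H_closed[OF \<gamma>]])
  let ?dh = "coboundary E (int m) (H \<gamma>) (diffs E (Suc m) p)"
  have dh: "?dh = (\<Prod>i\<le>Suc m. h i powi ((-1) ^ i))"
    unfolding coboundary_diffs[OF group_E p] h_def ..
  have dh0: "?dh \<noteq> 0" unfolding dh using h0 by (simp del: prod.atMost_Suc)
  \<comment> \<open>Omitting the only vertex of the first coset leaves a face without translated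
    vertices and no error. Omitting the only vertex of the last coset leaves a face on which
    \<open>Q\<close> is translated but \<open>lift\<close> is not; \<open>W_translate\<close>
    measures the difference. All other faces meet both cosets and carry just the \<open>H\<close>
    factor.\<close>
  define e where "e i = (if i = 0 \<and> a = 0 then 1 else if i = Suc (Suc m) \<and> a = Suc m then inverse ?dh
      else h i powi ((-1) ^ m))" for i
  have face: "lift (diffs E (Suc m) (p \<circ> skip i)) = W (diffs E (Suc m) (Q \<circ> skip i)) * e i"
    if i: "i \<le> Suc (Suc m)" for i
  proof -
    let ?p = "p \<circ> skip i"
    note r = range_comp_subset[OF p, of "skip i"]
    consider (first) "i = 0" "a = 0" | (last) "i = Suc (Suc m)" "a = Suc m"
      | (generic) "\<not> (i = 0 \<and> a = 0)" "\<not> (i = Suc (Suc m) \<and> a = Suc m)" by blast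
    then show ?thesis
    proof cases
      case first
      have "vertex_lift ?p = W (diffs E (Suc m) ?p)"
      proof (rule vertex_lift_constant[OF r])
        fix j assume "j \<le> Suc m"
        then show "\<pi> (?p j) = \<pi> (?p 0)"
          using c1[of "Suc j"] c1[of "Suc 0"] first by (simp add: skip_def)
      qed
      moreover have "diffs E (Suc m) ?p = diffs E (Suc m) (Q \<circ> skip i)"
        using pE by (intro diffs_cong) (simp add: Q_def skip_def first)
      ultimately show ?thesis using first lift_diffs[OF r] by (simp add: e_def)
    next
      case last
      have "vertex_lift ?p = W (diffs E (Suc m) ?p)"
      proof (rule vertex_lift_constant[OF r])
        fix j assume "j \<le> Suc m"
        then show "\<pi> (?p j) = \<pi> (?p 0)"
          using c0[of j] c0[of 0] last by (simp add: skip_def)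
      qed
      moreover have "diffs E (Suc m) ?p = diffs E (Suc m) p"
        by (intro diffs_cong) (simp add: skip_def last)
      moreover have "diffs E (Suc m) (Q \<circ> skip i) = diffs E (Suc m) (\<lambda>j. p j \<otimes>\<^bsub>E\<^esub> s \<gamma>)"
        by (intro diffs_cong) (simp add: Q_def skip_def last)
      moreover have "W (diffs E (Suc m) (\<lambda>j. p j \<otimes>\<^bsub>E\<^esub> s \<gamma>)) = ?dh * W (diffs E (Suc m) p)"
      proof (rule W_translate[OF p _ \<gamma>])
        fix j assume "j \<le> Suc m"
        then show "\<pi> (p j) = \<pi> (p 0)" using c0[of j] c0[of 0] last by simp
      qed
      ultimately show ?thesis using last lift_diffs[OF r] dh0 by (simp add: e_def)
    next
      case generic
      \<comment> \<open>An end vertex is omitted only if its neighbour lies in the same coset, so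
        the face still starts in \<open>c0\<close> and ends in \<open>c1\<close>.\<close>
      have first_class: "\<pi> (?p 0) = c0"
        using generic i c0[of 0] c0[of "Suc 0"] by (cases "i = 0") (simp_all add: skip_def)
      have "\<pi> (?p (Suc m)) = c1"
        using generic i a c1[of "Suc m"] c1[of "Suc (Suc m)"]
        by (cases "i = Suc (Suc m)") (simp_all add: skip_def)
      then have ec: "end_class ?p = \<gamma>" using first_class by (simp add: end_class_def \<gamma>_def)
      have "diffs E (Suc m) (twist ?p) = diffs E (Suc m) (Q \<circ> skip i)"
      proof (rule diffs_cong)
        fix j assume "j \<le> Suc m"
        then have "skip i j \<le> Suc (Suc m)" by (simp add: skip_def)
        then have "\<pi> (?p j) = c0 \<longleftrightarrow> skip i j \<le> a"
          using c0[of "skip i j"] c1[of "skip i j"] ne by (cases "skip i j \<le> a") auto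
        then show "twist ?p j = (Q \<circ> skip i) j"
          unfolding twist_def ec first_class by (simp add: Q_def)
      qed
      moreover have "e i = h i powi ((-1) ^ m)" using generic by (auto simp: e_def)
      ultimately show ?thesis
        unfolding lift_diffs[OF r] vertex_lift_def ec by (simp add: h_def)
    qed
  qed
  have "coboundary E (int (Suc m)) lift (diffs E (Suc (Suc m)) p)
      = (\<Prod>i\<le>Suc (Suc m). (W (diffs E (Suc m) (Q \<circ> skip i)) * e i) powi ((-1) ^ i))"
    unfolding coboundary_diffs[OF group_E p] by (intro prod.cong) (simp_all add: face)
  also have "\<dots> = (\<Prod>i\<le>Suc (Suc m). e i powi ((-1) ^ i))"
    using dW unfolding coboundary_diffs[OF group_E Q] by (simp only: power_int_mult_distrib prod.distrib mult_1)
  also have "\<dots> = 1"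
  proof (cases "a = Suc m")
    \<comment> \<open>Only the last vertex is in the second coset: the \<open>H\<close> factors of
      the other faces combine to a power of \<open>?dh\<close> that cancels the error on the last
      face.\<close>
    case True
    have "e i powi ((-1) ^ i) = (h i powi ((-1) ^ i)) powi ((-1) ^ m)" if "i \<le> Suc m" for i
      using that True by (simp add: e_def power_int_mult[symmetric] mult.commute)
    then have "(\<Prod>i\<le>Suc m. e i powi ((-1) ^ i)) = ?dh powi ((-1) ^ m)"
      unfolding dh prod_powi by (intro prod.cong) simp_all
    moreover have "e (Suc (Suc m)) powi ((-1) ^ Suc (Suc m)) = inverse (?dh powi ((-1) ^ m))"
      using True by (simp add: e_def power_int_inverse)
    ultimately show ?thesis using dh0 by (subst prod.atMost_Suc) simp
  next
    case False
    have one: "h i = 1" if "j \<le> m" "\<pi> (p (skip i j)) \<noteq> \<pi> (p (skip i 0))" for i j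
      unfolding h_def
      using that by (intro extend_outside) (auto simp: diffs_in_N_iff[OF range_comp_subset[OF p]])
    \<comment> \<open>Apart from the face without error, \<open>h i\<close> is 1 because the
      vertices left after dropping the last one of face \<open>i\<close> meet both cosets. This
      fails only for \<open>a = m\<close>, where the faces \<open>Suc m\<close> and
      \<open>Suc (Suc m)\<close> both leave the vertices up to \<open>m\<close> and cancel by
      sign.\<close>
    have e1: "e i = 1" if i: "i \<le> Suc (Suc m)" "\<not> (a = m \<and> i \<in> {Suc m, Suc (Suc m)})" for i
    proof (cases "i = 0 \<and> a = 0")
      case nz: False
      have "\<pi> (p (skip i 0)) = c0"
        using nz c0[of 0] c0[of "Suc 0"] by (cases "i = 0") (simp_all add: skip_def)
      moreover have "\<pi> (p (skip i m)) = c1"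
        using i a False c1[of m] c1[of "Suc m"] by (cases "i \<le> m") (auto simp: skip_def)
      ultimately have "h i = 1" using one[of m i] ne by simp
      then show ?thesis using False nz by (auto simp: e_def)
    qed (simp add: e_def)
    show ?thesis
    proof (cases "a = m")
      case True
      have "h (Suc (Suc m)) = h (Suc m)"
        unfolding h_def by (intro arg_cong[of _ _ "H \<gamma>"] diffs_cong) (simp add: skip_def)
      then have eq: "e (Suc (Suc m)) = e (Suc m)" using True by (simp add: e_def)
      have ne0: "e (Suc m) \<noteq> 0" using h0 True by (simp add: e_def)
      have "(\<Prod>i\<le>Suc (Suc m). e i powi ((-1) ^ i)) = (\<Prod>i\<in>{Suc m, Suc (Suc m)}. e i powi ((-1) ^ i))"
        by (rule prod.mono_neutral_right) (auto simp: e1)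
      also have "\<dots> = e (Suc m) powi ((-1) ^ Suc m) * e (Suc m) powi ((-1) ^ Suc (Suc m))"
        by (simp add: eq)
      also have "\<dots> = 1" by (rule powi_mult_minus[OF ne0])
      finally show ?thesis .
    next
      case False
      then show ?thesis by (intro prod.neutral) (simp add: e1)
    qed
  qed
  finally show ?thesis .
qed

lemma lift_in_ss_Z: "lift \<in> ss_Z E N 2 0 (int (Suc m))"
proof -
  \<comment> \<open>In filtration 2 of degree \<open>m + 2\<close> the threshold is
    \<open>m + 1\<close>. So at most one of the \<open>m + 2\<close> entries lies outside
    \<open>N\<close>, and the vertices change coset at most once, after position
    \<open>a\<close>.\<close>
  have "coboundary E (int (Suc m)) lift xs = 1"
    if xs: "xs \<in> tuples E (int (Suc m) + 1)"
      and card: "Suc m \<le> card {j. j < length xs \<and> xs ! j \<in> N}" for xs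
  proof -
    have xs': "xs \<in> tuples E (int (Suc (Suc m)))" using xs by (simp add: add.commute)
    obtain p where p: "range p \<subseteq> carrier E" and xsp: "xs = diffs E (Suc (Suc m)) p"
      using tuples_diffsE[OF group_E E.one_closed xs'] by metis
    have pE: "p k \<in> carrier E" for k using p by auto
    let ?I = "{j. j < Suc (Suc m) \<and> xs ! j \<in> N}" and ?O = "{j. j < Suc (Suc m) \<and> xs ! j \<notin> N}"
    have "card (?I \<union> ?O) = card ?I + card ?O" by (rule card_Un_disjoint) auto
    moreover have "?I \<union> ?O = {..<Suc (Suc m)}" by auto
    ultimately have "card ?O \<le> 1" using card by (simp add: xsp)
    then obtain a where a: "a \<le> Suc m" "?O \<subseteq> {a}"
      using card_le_Suc0_iff_eq[of ?O] by (cases "?O = {}") (auto simp: less_Suc_eq_le)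
    have step: "\<pi> (p (Suc j)) = \<pi> (p j)" if "j < Suc (Suc m)" "j \<noteq> a" for j
    proof -
      have "xs ! j \<in> N" using a(2) that by blast
      then show ?thesis using that(1) quotient_mem_N_iff[OF pE pE] by (simp add: xsp)
    qed
    have c0: "\<pi> (p j) = \<pi> (p 0)" if "j \<le> a" for j
      using that by (induction j) (use step a in auto)
    have c1: "\<pi> (p j) = \<pi> (p (Suc a))" if "a < j" "j \<le> Suc (Suc m)" for j
      using that
    proof (induction j)
      case (Suc j)
      then show ?case using step[of j] by (cases "j = a") auto
    qed simp
    show ?thesis
    proof (cases "\<pi> (p 0) = \<pi> (p (Suc a))")
      case True
      have "\<pi> (p j) = \<pi> (p 0)" if "j \<le> Suc (Suc m)" for j
        using c0[of j] c1[of j] that True by (cases "j \<le> a") (metis not_le)+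
      then show ?thesis unfolding xsp by (rule coboundary_lift_constant[OF p])
    next
      case False
      show ?thesis unfolding xsp by (rule coboundary_lift_break[OF p a(1) c0 c1 False])
    qed
  qed
  then show ?thesis
    using lift_closed coboundary_closed[OF group_E lift_closed]
    by (simp add: ss_Z_iff[of 0 "int (Suc m)" "int (Suc m)"] filt_nonpos filt_iff del: of_nat_Suc)
qed

end

context group_extension
begin

lemma lift_to_second_page:
  assumes \<omega>: "\<omega> \<in> cocycles D (int n)" and inv: "coh_class D (int n) \<omega> \<in> coh_invariants D E G \<iota> \<pi> (int n)"
  shows "\<exists>f\<in>ss_Z E N 2 0 (int n). pullback D (int n) \<iota> f = \<omega>"
proof (cases n)
  case 0
  have \<omega>c: "\<omega> \<in> carrier (cochains D 0)" using \<omega> 0 by (simp add: cocycles_iff)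
  \<comment> \<open>A 0-cochain is a scalar; the two factors of its coboundary are inverse to each
    other.\<close>
  have "coboundary E 0 (extend 0 \<omega>) = (\<lambda>_. 1)"
  proof
    fix xs
    show "coboundary E 0 (extend 0 \<omega>) xs = 1"
    proof (cases "xs \<in> tuples E 1")
      case True
      then obtain x where "xs = [x]" by (auto simp: tuples_def length_Suc_conv)
      then show ?thesis
        using cochain_nonzero[OF extend_closed[OF \<omega>c], of "[]"] by (simp add: coboundary_def power_int_minus)
    qed (simp add: coboundary_outside)
  qed
  then show ?thesis
    using 0 extend_closed[OF \<omega>c] pullback_extend[OF \<omega>c]
    by (intro bexI[of _ "extend 0 \<omega>"]) (auto simp: ss_Z_iff[of 0 0 0] filt_nonpos)
next
  case (Suc m)
  have \<omega>c: "\<omega> \<in> carrier (cochains D (int (Suc m)))" "coboundary D (int (Suc m)) \<omega> = (\<lambda>_. 1)"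
    using \<omega> Suc by (simp_all add: cocycles_iff)
  have "\<forall>\<gamma>\<in>carrier G. \<exists>\<eta>\<in>carrier (cochains D (int m)).
    pullback D (int (Suc m)) (conj_aut D E \<iota> (\<sigma> \<gamma>)) \<omega> = (\<lambda>xs. coboundary D (int m) \<eta> xs * \<omega> xs)"
    using invariant_class_conj[OF \<omega>c(1)] inv by (simp add: Suc)
  then obtain \<eta> where \<eta>: "\<And>\<gamma>. \<gamma> \<in> carrier G \<Longrightarrow> \<eta> \<gamma> \<in> carrier (cochains D (int m))"
    "\<And>\<gamma>. \<gamma> \<in> carrier G \<Longrightarrow> pullback D (int (Suc m)) (conj_aut D E \<iota> (\<sigma> \<gamma>)) \<omega>
        = (\<lambda>xs. coboundary D (int m) (\<eta> \<gamma>) xs * \<omega> xs)"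
    by metis
  have "conj_aut D E \<iota> \<one>\<^bsub>E\<^esub> d = d" if "d \<in> carrier D" for d
    using that \<iota>_inj by (simp add: conj_aut_def)
  then have "map (conj_aut D E \<iota> \<one>\<^bsub>E\<^esub>) ds = ds" if "ds \<in> tuples D (int (Suc m))" for ds
    using that by (auto simp: tuples_def subset_iff intro!: map_idI)
  then have conj_one: "pullback D (int (Suc m)) (conj_aut D E \<iota> \<one>\<^bsub>E\<^esub>) \<omega> = \<omega>"
    using cochain_outside[OF \<omega>c(1)] by (auto simp: pullback_def fun_eq_iff)
  \<comment> \<open>The value of \<open>\<sigma>\<close> at the unit need not be the unit, so
    section and correcting cochain are redefined there; \<open>conj_one\<close> preserves the
    conjugation hypothesis.\<close>
  interpret invariant_cocycle D E G \<iota> \<pi> m \<omega> "\<lambda>\<gamma>. if \<gamma> = \<one>\<^bsub>G\<^esub> then \<one>\<^bsub>E\<^esub> else \<sigma> \<gamma>"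
    "\<lambda>\<gamma>. if \<gamma> = \<one>\<^bsub>G\<^esub> then (\<lambda>_. 1) else \<eta> \<gamma>"
    by unfold_locales (auto simp: \<omega>c \<eta> \<sigma>_closed \<pi>_\<sigma> conj_one simp del: of_nat_Suc)
  show ?thesis using lift_in_ss_Z pullback_lift Suc by auto
qed

end

section \<open>Climbing the pages and reading off the coboundary\<close>

theorem proposition3p31:
  fixes D :: "'d monoid" and Ghat :: "'e monoid" and G :: "'g monoid"
    and \<iota> :: "'d \<Rightarrow> 'e" and \<pi> :: "'e \<Rightarrow> 'g"
    and n :: nat and \<omega> :: "'d list \<Rightarrow> complex"
  assumes "group D" and "group Ghat" and "group G"
    and "\<iota> \<in> hom D Ghat" and "inj_on \<iota> (carrier D)"
    and "\<pi> \<in> hom Ghat G" and "\<pi> ` carrier Ghat = carrier G"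
    and "\<iota> ` carrier D = kernel Ghat G \<pi>"
    and "\<omega> \<in> cocycles D (int n)"
    and "coh_class D (int n) \<omega> \<in> coh_invariants D Ghat G \<iota> \<pi> (int n)"
  shows "((\<forall>i \<in> {2..int n + 1}. obstruction_vanishes D Ghat \<iota> (int n) \<omega> i) \<longrightarrow>
           (\<exists>\<omega>hat \<in> cocycles Ghat (int n). pullback D (int n) \<iota> \<omega>hat = \<omega>))
       \<and> ((\<forall>i \<in> {2..int n}. obstruction_vanishes D Ghat \<iota> (int n) \<omega> i) \<longrightarrow>
           (\<exists>\<omega>' \<in> carrier (cochains Ghat (int n)). \<exists>\<theta> \<in> cocycles G (int n + 1).
              pullback D (int n) \<iota> \<omega>' = \<omega> \<and>
              coboundary Ghat (int n) \<omega>' = pullback Ghat (int n + 1) \<pi> \<theta>))"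
proof -
  interpret group_extension D Ghat G \<iota> \<pi>
    by (rule group_extension.intro) (fact assms)+
  obtain f where f: "f \<in> ss_Z Ghat N 2 0 (int n)" "pullback D (int n) \<iota> f = \<omega>"
    using lift_to_second_page assms by blast
  have page: "\<exists>f\<in>ss_Z Ghat N r 0 (int n). pullback D (int n) \<iota> f = \<omega>"
    if obs: "\<forall>i\<in>{2..r - 1}. obstruction_vanishes D Ghat \<iota> (int n) \<omega> i" and r: "2 \<le> r" for r
  proof -
    obtain g where "g \<in> ss_Z Ghat N r 0 (int n)"
      "coh_class D (int n) (pullback D (int n) \<iota> g) = coh_class D (int n) \<omega>"
      using lift_page[OF f(1) _ _ r, of \<omega>] f(2) obs by auto
    then show ?thesis by (rule lift_exact)
  qed
  have ss_Z: "g \<in> carrier (cochains Ghat (int n)) \<and> coboundary Ghat (int n) g \<in> filt Ghat N r (int n + 1)"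
    if "g \<in> ss_Z Ghat N r 0 (int n)" for g r
    using that by (simp add: ss_Z_iff[of 0 "int n" "int n"] filt_nonpos)
  show ?thesis
  proof (intro conjI impI)
    assume "\<forall>i\<in>{2..int n + 1}. obstruction_vanishes D Ghat \<iota> (int n) \<omega> i"
    \<comment> \<open>On page \<open>n + 2\<close> the coboundary has filtration
      \<open>n + 2\<close> in degree \<open>n + 1\<close>, where \<open>filt\<close> is
      trivial.\<close>
    then obtain g where "g \<in> ss_Z Ghat N (int n + 2) 0 (int n)" "pullback D (int n) \<iota> g = \<omega>"
      using page[of "int n + 2"] by auto
    then show "\<exists>\<omega>hat\<in>cocycles Ghat (int n). pullback D (int n) \<iota> \<omega>hat = \<omega>"
      using ss_Z[of g "int n + 2"] by (auto simp: cocycles_iff filt_iff)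
  next
    assume obs: "\<forall>i\<in>{2..int n}. obstruction_vanishes D Ghat \<iota> (int n) \<omega> i"
    \<comment> \<open>The induction over pages starts at 2, which exceeds \<open>n + 1\<close> for
      \<open>n = 0\<close>; then the range of obstructions is empty.\<close>
    have range: "\<forall>i\<in>{2..max 2 (int n + 1) - 1}. obstruction_vanishes D Ghat \<iota> (int n) \<omega> i"
      using obs by (auto simp: max_def split: if_splits)
    obtain g where g: "g \<in> ss_Z Ghat N (max 2 (int n + 1)) 0 (int n)" "pullback D (int n) \<iota> g = \<omega>"
      using page[of "max 2 (int n + 1)", OF range] by auto
    define c where "c = coboundary Ghat (int n) g"
    have gc: "g \<in> carrier (cochains Ghat (int n))" using ss_Z[OF g(1)] by simp
    have c: "c \<in> carrier (cochains Ghat (int (Suc n)))" "coboundary Ghat (int (Suc n)) c = (\<lambda>_. 1)"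
      using coboundary_closed[OF group_E gc] coboundary_coboundary[OF group_E gc]
      by (simp_all add: c_def add.commute)
    \<comment> \<open>In filtration \<open>n + 1\<close> of degree \<open>n + 1\<close> the
      threshold is 1: one entry in \<open>N\<close> suffices for \<open>c\<close> to be 1.\<close>
    have "c \<in> filt Ghat N (int n + 1) (int n + 1)"
      unfolding c_def by (rule subsetD[OF filt_antimono conjunct2[OF ss_Z[OF g(1)]]]) simp
    moreover have "1 \<le> card {j. j < length xs \<and> xs ! j \<in> N}" if meets: "set xs \<inter> N \<noteq> {}" for xs
    proof -
      obtain j where "j < length xs" "xs ! j \<in> N" using meets by (metis disjoint_iff in_set_conv_nth)
      then have "{j. j < length xs \<and> xs ! j \<in> N} \<noteq> {}" by blast
      then have "0 < card {j. j < length xs \<and> xs ! j \<in> N}" by (simp only: card_gt_0_iff) simp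
      then show ?thesis by simp
    qed
    ultimately have "c xs = 1" if "xs \<in> tuples Ghat (int (Suc n))" "set xs \<inter> N \<noteq> {}" for xs
      using that by (force simp: filt_iff add.commute)
    from cocycle_inflated[OF c this]
    obtain \<theta> where "\<theta> \<in> cocycles G (int n + 1)" "c = pullback Ghat (int n + 1) \<pi> \<theta>"
      by (auto simp: add.commute)
    then show "\<exists>\<omega>'\<in>carrier (cochains Ghat (int n)). \<exists>\<theta>\<in>cocycles G (int n + 1).
        pullback D (int n) \<iota> \<omega>' = \<omega> \<and> coboundary Ghat (int n) \<omega>' = pullback Ghat (int n + 1) \<pi> \<theta>"
      using gc g(2) unfolding c_def by blast
  qed
qed

end
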